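(* Let $\mathfrak{o}$ be a Dedekind domain, let $n$ be a positive integer, and let $\mathfrak{a}_1,\ldots,\mathfrak{a}_n$, $\mathfrak{b}_1,\ldots,\mathfrak{b}_n$, $\mathfrak{c}_1,\ldots,\mathfrak{c}_n$ be nonzero ideals of $\mathfrak{o}$. The triple $((\mathfrak{a}_1,\ldots,\mathfrak{a}_n),(\mathfrak{b}_1,\ldots,\mathfrak{b}_n),(\mathfrak{c}_1,\ldots,\mathfrak{c}_n))$ is not realisable if one of the following conditions is violated: (1) $\mathfrak{a}_n$, $\mathfrak{b}_n$ and $\mathfrak{c}_n$ are principal ideals. (2) $\mathfrak{a}_1^2 \mid \mathfrak{a}_2$, $\mathfrak{b}_1^2 \mid \mathfrak{b}_2$ and $\mathfrak{c}_1^2 \mid \mathfrak{c}_2$ (this condition being void if $n=1$). (3) $\mathfrak{a}_{k-1}^2\mathfrak{a}_{k-2}^{-1} \mid \mathfrak{a}_k$, $\mathfrak{b}_{k-1}^2\mathfrak{b}_{k-2}^{-1} \mid \mathfrak{b}_k$ and $\mathfrak{c}_{k-1}^2\mathfrak{c}_{k-2}^{-1} \mid \mathfrak{c}_k$ for all $3 \le k \le n$. (4) $\mathfrak{a}_n\mathfrak{b}_n = \mathfrak{c}_n$. (5) $\mathfrak{a}_k\mathfrak{b}_k \mid \mathfrak{c}_k$ for all $1 \le k < n$. (6) $\mathfrak{c}_k \mid \mathfrak{a}_k\mathfrak{b}_k\left(\mathfrak{a}_n\mathfrak{a}_k^{-1}\mathfrak{a}_{n-k}^{-1} + \mathfrak{b}_n\mathfrak{b}_k^{-1}\mathfrak{b}_{n-k}^{-1}\right)$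 for all $1 \le k < n$.
   Context: $I_n$ denotes the set of $n \times n$ matrices with entries in $\mathfrak{o}$ and non-zero determinant. For $A \in \mathfrak{o}^{n\times n}$ and $1 \le k \le n$, the $k$-th determinantal divisor $\mathfrak{d}_k(A)$ is the ideal of $\mathfrak{o}$ generated by all $k\times k$ minors of $A$ (their ideal-theoretic g.c.d.). The triple $((\mathfrak{a}_1,\ldots,\mathfrak{a}_n),(\mathfrak{b}_1,\ldots,\mathfrak{b}_n),(\mathfrak{c}_1,\ldots,\mathfrak{c}_n))$ is called realisable if there exist matrices $A, B \in I_n$ such that $\mathfrak{d}_k(A)=\mathfrak{a}_k$, $\mathfrak{d}_k(B)=\mathfrak{b}_k$ and $\mathfrak{d}_k(AB)=\mathfrak{c}_k$ for all $1 \le k \le n$. Inverses, products and sums are those of fractional ideals in the field of fractions of $\mathfrak{o}$, and for fractional ideals $\mathfrak{a} \mid \mathfrak{b}$ means $\mathfrak{b} \subseteq \mathfrak{a}$. *)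

theory Defs
  imports
    "HOL-Algebra.Ring_Divisibility"
    "HOL-Computational_Algebra.Polynomial_Factorial"
    "Jordan_Normal_Form.Determinant"
    "Jordan_Normal_Form.VS_Connect"
    "Jordan_Normal_Form.DL_Submatrix"
begin

text \<open>
  The ring \<open>\<oo>\<close> is the type \<open>'a::idom\<close>, and its field of fractions \<open>K\<close> is \<open>'a fract\<close>. Notions
  of HOL-Algebra (ideals, prime ideals, ...) are applied to \<open>class_ring\<close>, the ring record whose
  carrier is the whole type.
\<close>

definition integrally_closed :: "'a::idom itself \<Rightarrow> bool" where
  "integrally_closed _ \<longleftrightarrow>
     (\<forall>x::'a fract. (\<exists>p::'a poly. lead_coeff p = 1 \<and> poly (map_poly to_fract p) x = 0)
        \<longrightarrow> x \<in> range to_fract)"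

text \<open>Fields are not excluded: a field satisfies all three conditions.\<close>

definition dedekind_domain :: "'a::idom itself \<Rightarrow> bool" where
  "dedekind_domain _ \<longleftrightarrow>
     noetherian_ring (class_ring :: 'a ring) \<and>
     integrally_closed TYPE('a) \<and>
     (\<forall>P. primeideal P (class_ring :: 'a ring) \<and> P \<noteq> {0} \<longrightarrow> maximalideal P (class_ring :: 'a ring))"

text \<open>
  Fractional ideals are \<open>\<oo>\<close>-submodules of \<open>K\<close>, represented as sets. The library product of
  ideals lives in a single ring, whereas here one needs \<open>\<oo>\<close>-spans inside \<open>K\<close>.
\<close>

interpretation fract_module: Modules.module "\<lambda>(r::'a::idom) (x::'a fract). to_fract r * x"
  by unfold_locales (simp_all add: algebra_simps)

definition frac_of :: "'a::idom set \<Rightarrow> 'a fract set" where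
  "frac_of I = to_fract ` I"

definition frac_mult :: "'a::idom fract set \<Rightarrow> 'a fract set \<Rightarrow> 'a fract set"
    (infixl \<open>\<cdot>\<^sub>F\<close> 70) where
  "I \<cdot>\<^sub>F J = fract_module.span {x * y | x y. x \<in> I \<and> y \<in> J}"

definition frac_plus :: "'a::idom fract set \<Rightarrow> 'a fract set \<Rightarrow> 'a fract set"
    (infixl \<open>+\<^sub>F\<close> 65) where
  "I +\<^sub>F J = {x + y | x y. x \<in> I \<and> y \<in> J}"

text \<open>The inverse of \<open>I\<close> is the ideal quotient \<open>(\<oo> : I)\<close>.\<close>

definition frac_inv :: "'a::idom fract set \<Rightarrow> 'a fract set" where
  "frac_inv I = {x. \<forall>y\<in>I. x * y \<in> range to_fract}"

definition frac_dvd :: "'a::idom fract set \<Rightarrow> 'a fract set \<Rightarrow> bool" (infix \<open>dvd\<^sub>F\<close> 50) where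
  "I dvd\<^sub>F J \<longleftrightarrow> J \<subseteq> I"

definition nonsing_mats :: "nat \<Rightarrow> 'a::idom mat set" where
  "nonsing_mats n = {A \<in> carrier_mat n n. det A \<noteq> 0}"

definition det_divisor :: "nat \<Rightarrow> 'a::idom mat \<Rightarrow> 'a set" where
  "det_divisor k A = Idl\<^bsub>class_ring\<^esub>
     {det (submatrix A I J) | I J.
        I \<subseteq> {..<dim_row A} \<and> J \<subseteq> {..<dim_col A} \<and> card I = k \<and> card J = k}"

text \<open>Families \<open>\<aa>\<^sub>1, \<dots>, \<aa>\<^sub>n\<close> are functions on \<open>nat\<close>, of which only the values on \<open>{1..n}\<close> matter.\<close>

definition realisable ::
  "nat \<Rightarrow> (nat \<Rightarrow> 'a::idom set) \<Rightarrow> (nat \<Rightarrow> 'a set) \<Rightarrow> (nat \<Rightarrow> 'a set) \<Rightarrow> bool" where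
  "realisable n a b c \<longleftrightarrow>
     (\<exists>A \<in> nonsing_mats n. \<exists>B \<in> nonsing_mats n. \<forall>k \<in> {1..n}.
        det_divisor k A = a k \<and> det_divisor k B = b k \<and> det_divisor k (A * B) = c k)"

end

theory Submission
  imports Defs "Jordan_Normal_Form.Char_Poly"
begin

text \<open>
  View the \<open>k\<close>-th determinantal divisor of \<open>A\<close> as the \<open>\<oo>\<close>-submodule \<open>\<dd>\<^sub>k(A)\<close> of \<open>K\<close> that is spanned
  by the \<open>k \<times> k\<close> minors of \<open>A\<close>. All conditions are properties of these modules for \<open>A\<close>, \<open>B\<close> and \<open>AB\<close>.

  \<^item> Since \<open>\<dd>\<^sub>n(A)\<close> is generated by \<open>det A\<close>, the conditions on the last divisors are the multiplicativity
    of the determinant. The Cauchy-Binet formula gives \<open>\<dd>\<^sub>k(AB) \<subseteq> \<dd>\<^sub>k(A) \<dd>\<^sub>k(B)\<close>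
    (\<open>minor_module_product\<close>).

  \<^item> For the bound of \<open>\<cc>\<^sub>k\<close> in the other direction, apply Cauchy-Binet over \<open>K\<close> to \<open>B = A\<inverse>(AB)\<close>. By
    Jacobi's formula (\<open>minor_of_inverse\<close>) the \<open>k \<times> k\<close> minors of \<open>A\<inverse>\<close> are up to sign complementary
    minors of \<open>A\<close> divided by \<open>det A\<close>. Hence \<open>det A \<sqdot> \<dd>\<^sub>k(B) \<subseteq> \<dd>\<^sub>n\<^sub>-\<^sub>k(A) \<dd>\<^sub>k(AB)\<close>, and symmetrically
    \<open>det B \<sqdot> \<dd>\<^sub>k(A) \<subseteq> \<dd>\<^sub>n\<^sub>-\<^sub>k(B) \<dd>\<^sub>k(AB)\<close>; the two inclusions belong to the two summands of the bound.

  \<^item> The quadratic conditions say that \<open>\<dd>\<^sub>k(A) \<dd>\<^sub>k\<^sub>-\<^sub>2(A) \<subseteq> \<dd>\<^sub>k\<^sub>-\<^sub>1(A)\<^sup>2\<close>, where \<open>\<dd>\<^sub>0(A) = \<oo>\<close>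
    (\<open>minor_module_log_concave\<close>). This is where the Dedekind hypothesis enters. The inclusion may be
    checked at each maximal ideal \<open>P\<close>, and \<open>\<oo>\<^sub>P\<close> is a valuation ring. Instead of a Smith normal form
    over \<open>\<oo>\<^sub>P\<close>, the proof uses that the minors of \<open>A\<close> are the maximal minors of \<open>(A | 1)\<close>, which satisfy
    exchange relations: a product of two of them is a sum of products in which one column is swapped,
    and some term of that sum divides the product. So the valuations of the maximal minors behave like
    the weights of the bases of a valuated matroid, and these are concave in the number of columns
    that are taken from \<open>A\<close> (\<open>minors_log_concave\<close>).

  Both the valuation property of \<open>\<oo>\<^sub>P\<close> and the division by \<open>\<dd>\<^sub>k\<^sub>-\<^sub>2(A)\<close> rest on the invertibility of
  nonzero ideals, \<open>I I\<inverse> = \<oo>\<close> (\<open>one_in_frac_mult_inv\<close>). It follows from two facts: a proper nonzero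
  ideal \<open>J\<close> admits \<open>x \<in> K - \<oo>\<close> with \<open>x J \<subseteq> \<oo>\<close>, because \<open>\<oo>\<close> is Noetherian and its nonzero primes are
  maximal; and an element of \<open>K\<close> that stabilises a nonzero ideal lies in \<open>\<oo>\<close>, because \<open>\<oo>\<close> is
  integrally closed.
\<close>

section \<open>Ideals of a Noetherian ring\<close>

lemma ideal_class_ring_iff:
  fixes I :: "'a::comm_ring_1 set"
  shows "ideal I class_ring \<longleftrightarrow>
    0 \<in> I \<and> (\<forall>x\<in>I. \<forall>y\<in>I. x + y \<in> I) \<and> (\<forall>r. \<forall>x\<in>I. r * x \<in> I)"
proof
  assume I: "ideal I class_ring"
  then have "additive_subgroup I class_ring" by (rule ideal.axioms)
  then show "0 \<in> I \<and> (\<forall>x\<in>I. \<forall>y\<in>I. x + y \<in> I) \<and> (\<forall>r. \<forall>x\<in>I. r * x \<in> I)"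
    using additive_subgroup.zero_closed[of I class_ring] additive_subgroup.a_closed[of I class_ring]
      ideal.I_l_closed[OF I] by auto
next
  assume *: "0 \<in> I \<and> (\<forall>x\<in>I. \<forall>y\<in>I. x + y \<in> I) \<and> (\<forall>r. \<forall>x\<in>I. r * x \<in> I)"
  have neg: "- x \<in> I" if "x \<in> I" for x
    using * that by (metis mult_minus1)
  have inv: "inv\<^bsub>add_monoid class_ring\<^esub> x = - x" for x :: 'a
    using class_ring_simps(8) unfolding a_inv_def by metis
  show "ideal I class_ring"
  proof (rule idealI[OF class_ring.ring_axioms])
    show "subgroup I (add_monoid class_ring)"
      by unfold_locales (use * neg inv in auto)
    show "x \<otimes>\<^bsub>class_ring\<^esub> a \<in> I" "a \<otimes>\<^bsub>class_ring\<^esub> x \<in> I" if "a \<in> I" for a x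
      using * that by (simp_all add: mult.commute[of a x])
  qed
qed

lemmas ideal_class_ringD = ideal_class_ring_iff[THEN iffD1]

lemma noetherian_maximal_ideal:
  fixes S :: "'a::comm_ring_1 set set"
  assumes "noetherian_ring (class_ring :: 'a ring)" and "S \<noteq> {}"
    and "\<And>I. I \<in> S \<Longrightarrow> ideal I class_ring"
  shows "\<exists>M\<in>S. \<forall>X\<in>S. M \<subseteq> X \<longrightarrow> X = M"
proof (rule subset_Zorn_nonempty[OF assms(2)])
  fix C assume C: "C \<noteq> {}" "subset.chain S C"
  have "subset.chain {I. ideal I (class_ring :: 'a ring)} C"
    using C(2) assms(3) unfolding subset.chain_def by auto
  then have "\<Union>C \<in> C" by (rule noetherian_ring.ideal_chain_is_trivial[OF assms(1) C(1)])
  then show "\<Union>C \<in> S" using C(2) unfolding subset.chain_def by auto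
qed

lemma maximal_ideal_above:
  fixes J :: "'a::comm_ring_1 set"
  assumes noeth: "noetherian_ring (class_ring :: 'a ring)" and J: "ideal J class_ring" "J \<noteq> UNIV"
  obtains P where "maximalideal P class_ring" "J \<subseteq> P"
proof -
  let ?S = "{I. ideal I (class_ring :: 'a ring) \<and> J \<subseteq> I \<and> I \<noteq> UNIV}"
  have "\<exists>M\<in>?S. \<forall>X\<in>?S. M \<subseteq> X \<longrightarrow> X = M"
    by (rule noetherian_maximal_ideal[OF noeth]) (use J in auto)
  then obtain M where "M \<in> ?S" and max: "\<And>X. X \<in> ?S \<Longrightarrow> M \<subseteq> X \<Longrightarrow> X = M" by meson
  then have M: "ideal M class_ring" "J \<subseteq> M" "M \<noteq> UNIV" by auto
  have "maximalideal M class_ring"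
  proof (rule maximalidealI)
    show "K = M \<or> K = carrier class_ring" if "ideal K class_ring" "M \<subseteq> K" for K
      using max[of K] that M(2) by auto
  qed (use M in auto)
  then show ?thesis using that M(2) by simp
qed

lemma maximalideal_class_ringD:
  fixes P :: "'a::comm_ring_1 set"
  assumes "maximalideal P class_ring"
  shows "ideal P class_ring" "P \<noteq> UNIV" "1 \<notin> P" "\<And>a b. a * b \<in> P \<Longrightarrow> a \<in> P \<or> b \<in> P"
proof -
  show id: "ideal P class_ring" using assms by (rule maximalideal.axioms)
  show neq: "P \<noteq> UNIV" using maximalideal.I_notcarr[OF assms] by auto
  have "primeideal P class_ring"
    by (rule cring.maximalideal_prime[OF class_cring.is_cring assms])
  then show "\<And>a b. a * b \<in> P \<Longrightarrow> a \<in> P \<or> b \<in> P"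
    using primeideal.I_prime by fastforce
  show "1 \<notin> P"
  proof
    assume "1 \<in> P"
    then have "r * 1 \<in> P" for r using ideal_class_ringD[OF id] by blast
    then show False using neq by auto
  qed
qed

section \<open>Inverses of ideals in a Dedekind domain\<close>

text \<open>
  For \<open>0 \<noteq> a \<in> J\<close> and a maximal ideal \<open>P \<supseteq> J\<close>, consider the annihilators of the elements of
  \<open>\<oo>/a\<oo>\<close> that lie inside \<open>P\<close>; the one of \<open>1\<close> is \<open>a\<oo>\<close>. A maximal one among them, of \<open>b\<close> say, is
  prime: this is the usual argument for associated primes, with an extra multiplier outside \<open>P\<close>
  to come back below \<open>P\<close>. It is not zero, hence it is maximal and equal to \<open>P\<close>. So \<open>J b \<subseteq> a\<oo>\<close>
  but \<open>b \<notin> a\<oo>\<close>, and \<open>b/a\<close> is the desired element.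
\<close>

lemma dedekind_inverse_not_integral:
  fixes J :: "'a::idom set"
  assumes dd: "dedekind_domain TYPE('a)" and J: "ideal J class_ring" "J \<noteq> {0}" "J \<noteq> UNIV"
  obtains x :: "'a fract"
  where "x \<notin> range to_fract" "\<And>y. y \<in> J \<Longrightarrow> x * to_fract y \<in> range to_fract"
proof -
  have noeth: "noetherian_ring (class_ring :: 'a ring)"
    using dd unfolding dedekind_domain_def by auto
  obtain P where P: "maximalideal P class_ring" and JP: "J \<subseteq> P"
    using maximal_ideal_above[OF noeth J(1,3)] .
  note PD = maximalideal_class_ringD[OF P]
  obtain a where a: "a \<in> J" "a \<noteq> 0" using J ideal_class_ringD[OF J(1)] by auto
  define Q where "Q b = {r. a dvd r * b}" for b
  have Qid: "ideal (Q b) class_ring" for b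
    unfolding ideal_class_ring_iff Q_def by (simp add: distrib_right mult.assoc)
  have aQ: "a \<in> Q b" for b unfolding Q_def by simp
  let ?S = "{Q b | b. Q b \<subseteq> P}"
  have "Q 1 \<subseteq> J"
  proof
    fix r assume "r \<in> Q 1"
    then obtain c where "r = a * c" unfolding Q_def by auto
    then have "r = c * a" by (simp add: mult.commute)
    then show "r \<in> J" using ideal_class_ringD[OF J(1)] a(1) by simp
  qed
  have "\<exists>M\<in>?S. \<forall>X\<in>?S. M \<subseteq> X \<longrightarrow> X = M"
  proof (intro noetherian_maximal_ideal[OF noeth])
    show "?S \<noteq> {}" using \<open>Q 1 \<subseteq> J\<close> JP by blast
    show "ideal I class_ring" if "I \<in> ?S" for I using that Qid by auto
  qed
  then obtain M where M: "M \<in> ?S" "\<And>X. X \<in> ?S \<Longrightarrow> M \<subseteq> X \<Longrightarrow> X = M" by meson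
  from M(1) obtain b where bP: "Q b \<subseteq> P" and Mb: "M = Q b" by auto
  have max: "Q b' = Q b" if "Q b' \<subseteq> P" "Q b \<subseteq> Q b'" for b'
    using M(2)[of "Q b'"] that unfolding Mb by auto
  have prime: "r \<in> Q b \<or> s \<in> Q b" if rs: "r * s \<in> Q b" for r s
  proof (rule disjCI)
    assume s: "s \<notin> Q b"
    have "Q b \<subseteq> Q (r * b)" unfolding Q_def by (auto simp: mult.left_commute[of _ r b])
    moreover have "s \<in> Q (r * b)" using rs unfolding Q_def by (simp add: mult_ac)
    ultimately have "\<not> Q (r * b) \<subseteq> P" using max[of "r * b"] s by auto
    then obtain t where t: "t \<in> Q (r * b)" "t \<notin> P" by auto
    have "Q b \<subseteq> Q (t * b)" unfolding Q_def by (auto simp: mult.left_commute[of _ t b])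
    moreover have "Q (t * b) \<subseteq> P"
    proof
      fix u assume "u \<in> Q (t * b)"
      then have "u * t \<in> Q b" unfolding Q_def by (simp add: mult_ac)
      then show "u \<in> P" using bP PD(4) t(2) by blast
    qed
    ultimately have "Q (t * b) = Q b" by (intro max)
    moreover have "r \<in> Q (t * b)" using t(1) unfolding Q_def by (simp add: mult_ac)
    ultimately show "r \<in> Q b" by simp
  qed
  have "Q b \<noteq> UNIV" using bP PD(2) by auto
  have "primeideal (Q b) class_ring"
    by (rule primeidealI) (use Qid prime \<open>Q b \<noteq> UNIV\<close> class_cring.is_cring in auto)
  moreover have "Q b \<noteq> {0}" using aQ a by auto
  ultimately have "maximalideal (Q b) class_ring"
    using dd unfolding dedekind_domain_def by auto
  then have "P = Q b"
    using maximalideal.I_maximal[of "Q b" class_ring P] PD(1,2) bP by auto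
  show ?thesis
  proof (rule that[of "to_fract b / to_fract a"])
    show "to_fract b / to_fract a \<notin> range to_fract"
    proof
      assume "to_fract b / to_fract a \<in> range to_fract"
      then obtain c where "to_fract b / to_fract a = to_fract c" by auto
      then have "to_fract b = to_fract (a * c)" using a by (simp add: field_simps)
      then have "b = a * c" by (simp only: to_fract_eq_iff)
      then have "1 \<in> Q b" unfolding Q_def by simp
      then show False using bP PD(3) by auto
    qed
    fix y assume "y \<in> J"
    then have "y \<in> Q b" using JP \<open>P = Q b\<close> by auto
    then obtain c where "y * b = a * c" unfolding Q_def by auto
    then have "to_fract y * to_fract b = to_fract a * to_fract c"
      by (metis to_fract_mult)
    then have "to_fract b / to_fract a * to_fract y = to_fract c"
      using a by (simp add: field_simps)
    then show "to_fract b / to_fract a * to_fract y \<in> range to_fract" by auto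
  qed
qed

lemma subspace_frac_of:
  assumes "ideal I class_ring"
  shows "fract_module.subspace (frac_of I)"
proof (rule fract_module.subspaceI)
  note I = ideal_class_ringD[OF assms]
  show "0 \<in> frac_of I" unfolding frac_of_def using I by (metis image_eqI to_fract_0)
  show "x + y \<in> frac_of I" if "x \<in> frac_of I" "y \<in> frac_of I" for x y
    using that I unfolding frac_of_def by (metis (no_types, lifting) image_iff to_fract_add)
  show "to_fract r * x \<in> frac_of I" if "x \<in> frac_of I" for r x
    using that I unfolding frac_of_def by (metis (no_types, lifting) image_iff to_fract_mult)
qed

lemma frac_of_genideal:
  "frac_of (Idl\<^bsub>class_ring\<^esub> S) = fract_module.span (to_fract ` S)"
proof
  have id: "ideal (Idl\<^bsub>class_ring\<^esub> S) class_ring"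
    by (rule ring.genideal_ideal[OF class_ring.ring_axioms]) auto
  show "fract_module.span (to_fract ` S) \<subseteq> frac_of (Idl\<^bsub>class_ring\<^esub> S)"
  proof (rule fract_module.span_minimal[OF _ subspace_frac_of[OF id]])
    show "to_fract ` S \<subseteq> frac_of (Idl\<^bsub>class_ring\<^esub> S)"
      unfolding frac_of_def using ring.genideal_self[OF class_ring.ring_axioms, of S] by auto
  qed
  let ?T = "{x. to_fract x \<in> fract_module.span (to_fract ` S)}"
  have "ideal ?T class_ring"
    unfolding ideal_class_ring_iff
    by (auto intro: fract_module.span_zero fract_module.span_add fract_module.span_scale)
  then have "Idl\<^bsub>class_ring\<^esub> S \<subseteq> ?T"
    by (rule ring.genideal_minimal[OF class_ring.ring_axioms]) (auto intro: fract_module.span_base)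
  then show "frac_of (Idl\<^bsub>class_ring\<^esub> S) \<subseteq> fract_module.span (to_fract ` S)"
    unfolding frac_of_def by auto
qed

lemma to_fract_hom: "comm_ring_hom to_fract"
  by unfold_locales auto

text \<open>
  The determinant trick: multiplication by \<open>x\<close> on a finite generating set of \<open>N\<close> is given by a
  matrix \<open>C\<close> over \<open>\<oo>\<close>, so \<open>x\<close> is an eigenvalue of \<open>C\<close>, hence a root of the monic polynomial
  \<open>char_poly C\<close>.
\<close>

lemma stabiliser_integral:
  fixes N :: "'a::idom set" and x :: "'a fract"
  assumes dd: "dedekind_domain TYPE('a)" and N: "ideal N class_ring" "N \<noteq> {0}"
    and stab: "\<And>y. y \<in> N \<Longrightarrow> x * to_fract y \<in> to_fract ` N"
  shows "x \<in> range to_fract"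
proof -
  from dd have noeth: "noetherian_ring (class_ring :: 'a ring)" and ic: "integrally_closed TYPE('a)"
    unfolding dedekind_domain_def by auto
  obtain A where A: "finite A" "N = Idl\<^bsub>class_ring\<^esub> A"
    using noetherian_ring.finetely_gen[OF noeth N(1)] by auto
  define d where "d = card A"
  obtain h where h: "bij_betw h {0..<d} A"
    using ex_bij_betw_nat_finite[OF A(1)] d_def by auto
  have AN: "A \<subseteq> N" using A(2) ring.genideal_self[OF class_ring.ring_axioms, of A] by auto
  have span: "fract_module.span (to_fract ` A) = to_fract ` N"
    using frac_of_genideal[of A] A(2) unfolding frac_of_def by simp
  have "\<exists>c. x * to_fract (h i) = (\<Sum>j=0..<d. to_fract (c j) * to_fract (h j))" if i: "i < d" for i
  proof -
    have "h i \<in> N" using h i AN unfolding bij_betw_def by auto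
    then have "x * to_fract (h i) \<in> fract_module.span (to_fract ` A)"
      using stab span by simp
    then obtain u where u: "x * to_fract (h i) = (\<Sum>v\<in>to_fract ` A. to_fract (u v) * v)"
      using fract_module.span_finite[of "to_fract ` A"] A(1) by auto
    have "(\<Sum>v\<in>to_fract ` A. to_fract (u v) * v) = (\<Sum>v\<in>A. to_fract (u (to_fract v)) * to_fract v)"
      by (subst sum.reindex) (auto simp: inj_on_def)
    also have "\<dots> = (\<Sum>j=0..<d. to_fract (u (to_fract (h j))) * to_fract (h j))"
      by (rule sum.reindex_bij_betw[OF h, symmetric])
    finally show ?thesis using u by auto
  qed
  then obtain c where c: "\<And>i. i < d \<Longrightarrow>
      x * to_fract (h i) = (\<Sum>j=0..<d. to_fract (c i j) * to_fract (h j))"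
    by metis
  define C where "C = mat d d (\<lambda>(i,j). c i j)"
  have C: "C \<in> carrier_mat d d" unfolding C_def by simp
  define v where "v = vec d (\<lambda>i. to_fract (h i))"
  have "\<exists>i<d. h i \<noteq> 0"
  proof (rule ccontr)
    assume "\<not> ?thesis"
    then have "A \<subseteq> {0}" using h unfolding bij_betw_def by auto
    then have "N \<subseteq> {0}" unfolding A(2)
      by (intro ring.genideal_minimal[OF class_ring.ring_axioms]) (auto simp: ideal_class_ring_iff)
    then show False using N ideal_class_ringD[OF N(1)] by auto
  qed
  then have "v \<noteq> 0\<^sub>v d" unfolding v_def by (metis index_vec index_zero_vec(1) to_fract_eq_0_iff)
  moreover have "map_mat to_fract C *\<^sub>v v = x \<cdot>\<^sub>v v"
    by (rule eq_vecI) (auto simp: C_def v_def scalar_prod_def c)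
  ultimately have "eigenvector (map_mat to_fract C) v x"
    unfolding eigenvector_def v_def C_def by auto
  then have "poly (char_poly (map_mat to_fract C)) x = 0"
    using eigenvalue_root_char_poly[of "map_mat to_fract C" d x] C unfolding eigenvalue_def by auto
  then have "poly (map_poly to_fract (char_poly C)) x = 0"
    by (simp add: comm_ring_hom.char_poly_hom[OF to_fract_hom C])
  moreover have "lead_coeff (char_poly C) = 1" using degree_monic_char_poly[OF C] by simp
  ultimately show ?thesis using ic unfolding integrally_closed_def by blast
qed

lemma frac_mult_leI:
  assumes "fract_module.subspace L" and "\<And>x y. x \<in> I \<Longrightarrow> y \<in> J \<Longrightarrow> x * y \<in> L"
  shows "I \<cdot>\<^sub>F J \<subseteq> L"
  unfolding frac_mult_def by (rule fract_module.span_minimal) (use assms in auto)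

lemma frac_multI: "x \<in> I \<Longrightarrow> y \<in> J \<Longrightarrow> x * y \<in> I \<cdot>\<^sub>F J"
  unfolding frac_mult_def by (rule fract_module.span_base) auto

lemma subspace_frac_mult: "fract_module.subspace (I \<cdot>\<^sub>F J)"
  unfolding frac_mult_def by simp

text \<open>
  To show that all elements of a product ideal multiply \<open>z\<close> into \<open>L\<close>, it is enough, by this lemma,
  to treat the products that generate it.
\<close>

lemma subspace_quotient:
  assumes "fract_module.subspace L"
  shows "fract_module.subspace {x. x * z \<in> L}"
proof (rule fract_module.subspaceI)
  show "0 \<in> {x. x * z \<in> L}" using fract_module.subspace_0[OF assms] by simp
  show "x + y \<in> {x. x * z \<in> L}" if "x \<in> {x. x * z \<in> L}" "y \<in> {x. x * z \<in> L}" for x y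
    using that fract_module.subspace_add[OF assms] by (simp add: distrib_right)
  show "to_fract r * x \<in> {x. x * z \<in> L}" if "x \<in> {x. x * z \<in> L}" for r x
    using that fract_module.subspace_scale[OF assms, of "x * z" r] by (simp add: mult.assoc)
qed

lemma frac_mult3_leI:
  assumes L: "fract_module.subspace L"
    and "\<And>x y z. x \<in> I \<Longrightarrow> y \<in> J \<Longrightarrow> z \<in> H \<Longrightarrow> x * y * z \<in> L"
  shows "I \<cdot>\<^sub>F J \<cdot>\<^sub>F H \<subseteq> L"
proof (rule frac_mult_leI[OF L])
  fix w z assume w: "w \<in> I \<cdot>\<^sub>F J" and z: "z \<in> H"
  have "I \<cdot>\<^sub>F J \<subseteq> {x. x * z \<in> L}"
    by (rule frac_mult_leI[OF subspace_quotient[OF L]]) (use assms(2) z in auto)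
  then show "w * z \<in> L" using w by auto
qed

lemma span_mult_span_le:
  assumes L: "fract_module.subspace L" and "\<And>x y. x \<in> S \<Longrightarrow> y \<in> T \<Longrightarrow> x * y \<in> L"
  shows "fract_module.span S \<cdot>\<^sub>F fract_module.span T \<subseteq> L"
proof (rule frac_mult_leI[OF L])
  fix x y assume x: "x \<in> fract_module.span S" and y: "y \<in> fract_module.span T"
  have "fract_module.span T \<subseteq> {y. y * s \<in> L}" if "s \<in> S" for s
    by (rule fract_module.span_minimal[OF _ subspace_quotient[OF L]])
       (use assms(2) that in \<open>auto simp: mult.commute[of _ s]\<close>)
  then have "S \<subseteq> {x. x * y \<in> L}" using y by (auto simp: mult.commute[of _ y])
  then have "fract_module.span S \<subseteq> {x. x * y \<in> L}"
    by (rule fract_module.span_minimal[OF _ subspace_quotient[OF L]])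
  then show "x * y \<in> L" using x by auto
qed

lemma subspace_integers: "fract_module.subspace (range to_fract :: 'a::idom fract set)"
proof -
  have "ideal (UNIV :: 'a set) class_ring" unfolding ideal_class_ring_iff by auto
  from subspace_frac_of[OF this] show ?thesis unfolding frac_of_def .
qed

lemma subspace_frac_inv: "fract_module.subspace (frac_inv I)"
proof -
  have "frac_inv I = (\<Inter>y\<in>I. {x. x * y \<in> range to_fract})" unfolding frac_inv_def by auto
  then show ?thesis
    by (simp only:) (intro fract_module.subspace_Int subspace_quotient subspace_integers)
qed

lemma subspace_vimage_ideal:
  fixes L :: "'a::idom fract set"
  assumes "fract_module.subspace L"
  shows "ideal {r. to_fract r \<in> L} class_ring"
  unfolding ideal_class_ring_iff
  using fract_module.subspace_0[OF assms] fract_module.subspace_add[OF assms]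
    fract_module.subspace_scale[OF assms] by auto

text \<open>
  If the ideal \<open>J = I I\<inverse>\<close> were proper, there would be a non-integral \<open>x\<close> with \<open>x J \<subseteq> \<oo>\<close>. Then
  \<open>x I\<inverse> I \<subseteq> \<oo>\<close> means that \<open>x I\<inverse> \<subseteq> I\<inverse>\<close>, so \<open>x\<close> stabilises the ideal \<open>a I\<inverse> \<subseteq> \<oo>\<close> for any
  nonzero \<open>a \<in> I\<close>, and is integral after all.
\<close>

lemma one_in_frac_mult_inv:
  fixes I :: "'a::idom set"
  assumes dd: "dedekind_domain TYPE('a)" and I: "ideal I class_ring" "I \<noteq> {0}"
  shows "1 \<in> frac_of I \<cdot>\<^sub>F frac_inv (frac_of I)"
proof -
  let ?X = "frac_of I"
  let ?Y = "frac_inv ?X"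
  obtain a where a: "a \<in> I" "a \<noteq> 0" using I ideal_class_ringD[OF I(1)] by auto
  then have aX: "to_fract a \<in> ?X" unfolding frac_of_def by auto
  have one: "1 \<in> ?Y" unfolding frac_inv_def frac_of_def by auto
  define J where "J = {r. to_fract r \<in> ?X \<cdot>\<^sub>F ?Y}"
  have J: "ideal J class_ring"
    unfolding J_def by (rule subspace_vimage_ideal[OF subspace_frac_mult])
  have "a \<in> J" unfolding J_def using frac_multI[OF aX one] by simp
  then have "J \<noteq> {0}" using a(2) by auto
  have "J = UNIV"
  proof (rule ccontr)
    assume "J \<noteq> UNIV"
    then obtain x :: "'a fract" where x: "x \<notin> range to_fract"
      and xJ: "\<And>y. y \<in> J \<Longrightarrow> x * to_fract y \<in> range to_fract"
      using dedekind_inverse_not_integral[OF dd J \<open>J \<noteq> {0}\<close>] by blast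
    have stab: "x * z \<in> ?Y" if z: "z \<in> ?Y" for z
    proof -
      have "x * z * y \<in> range to_fract" if y: "y \<in> ?X" for y
      proof -
        obtain r where r: "z * y = to_fract r" using z y unfolding frac_inv_def by auto
        have "y * z \<in> ?X \<cdot>\<^sub>F ?Y" by (rule frac_multI[OF y z])
        then have "r \<in> J" unfolding J_def using r by (simp add: mult.commute)
        then show ?thesis using xJ[of r] r by (simp add: mult.assoc)
      qed
      then show ?thesis unfolding frac_inv_def by auto
    qed
    \<comment> \<open>\<open>N\<close> is \<open>a I\<inverse>\<close>, viewed as an ideal of \<open>\<oo>\<close>.\<close>
    define N where "N = {r. to_fract r \<in> {w. w * inverse (to_fract a) \<in> ?Y}}"
    have Nid: "ideal N class_ring" unfolding N_def
      by (rule subspace_vimage_ideal[OF subspace_quotient[OF subspace_frac_inv]])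
    have "a \<in> N" unfolding N_def using one a by simp
    then have "N \<noteq> {0}" using a(2) by auto
    have "x * to_fract r \<in> to_fract ` N" if r: "r \<in> N" for r
    proof -
      define z where "z = to_fract r * inverse (to_fract a)"
      have xz: "x * z \<in> ?Y" using stab r unfolding z_def N_def by auto
      have "x * to_fract r = x * z * to_fract a" using a unfolding z_def by simp
      moreover obtain t where t: "x * z * to_fract a = to_fract t"
        using xz aX unfolding frac_inv_def by auto
      moreover have "to_fract t * inverse (to_fract a) = x * z"
        using a by (simp flip: t)
      ultimately show ?thesis using xz unfolding N_def by auto
    qed
    then have "x \<in> range to_fract" by (rule stabiliser_integral[OF dd Nid \<open>N \<noteq> {0}\<close>])
    then show False using x by simp
  qed
  then have "1 \<in> J" by simp
  then show ?thesis unfolding J_def by simp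
qed

lemma le_mult_inverse:
  assumes L: "fract_module.subspace L" and le: "I \<cdot>\<^sub>F J \<subseteq> L" and one: "1 \<in> J \<cdot>\<^sub>F J'"
  shows "I \<subseteq> L \<cdot>\<^sub>F J'"
proof
  fix x assume x: "x \<in> I"
  have "J \<cdot>\<^sub>F J' \<subseteq> {w. w * x \<in> L \<cdot>\<^sub>F J'}"
  proof (rule frac_mult_leI[OF subspace_quotient[OF subspace_frac_mult]])
    fix y z assume "y \<in> J" "z \<in> J'"
    then have "x * y * z \<in> L \<cdot>\<^sub>F J'" using le frac_multI[OF x] by (intro frac_multI) auto
    then show "y * z \<in> {w. w * x \<in> L \<cdot>\<^sub>F J'}" by (simp add: mult_ac)
  qed
  then show "x \<in> L \<cdot>\<^sub>F J'" using one by auto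
qed

section \<open>Localisation at a maximal ideal\<close>

lemma mem_subspace_locally:
  fixes L :: "'a::idom fract set"
  assumes noeth: "noetherian_ring (class_ring :: 'a ring)" and L: "fract_module.subspace L"
    and loc: "\<And>P. maximalideal P (class_ring :: 'a ring) \<Longrightarrow> \<exists>s. s \<notin> P \<and> to_fract s * x \<in> L"
  shows "x \<in> L"
proof -
  let ?J = "{s. to_fract s \<in> {w. w * x \<in> L}}"
  have J: "ideal ?J class_ring" by (rule subspace_vimage_ideal[OF subspace_quotient[OF L]])
  have "?J = UNIV"
  proof (rule ccontr)
    assume "?J \<noteq> UNIV"
    then obtain P where "maximalideal P class_ring" "?J \<subseteq> P"
      using maximal_ideal_above[OF noeth J] by blast
    then show False using loc[of P] by auto
  qed
  then have "1 \<in> ?J" by simp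
  then show ?thesis by simp
qed

text \<open>
  That \<open>V\<close> contains \<open>0\<close>, \<open>1\<close> and \<open>-1\<close> follows from \<open>total\<close>, since each of them is its own inverse.
\<close>

locale valuation_subring =
  fixes V :: "'k::field set"
  assumes add_closed: "x \<in> V \<Longrightarrow> y \<in> V \<Longrightarrow> x + y \<in> V"
    and mult_closed: "x \<in> V \<Longrightarrow> y \<in> V \<Longrightarrow> x * y \<in> V"
    and total: "x \<in> V \<or> inverse x \<in> V"

definition local_ring_at :: "'a::idom set \<Rightarrow> 'a fract set" where
  "local_ring_at P = {to_fract r / to_fract s | r s. s \<notin> P}"

text \<open>
  For \<open>x = a/b\<close>, invertibility of the ideal generated by \<open>a\<close> and \<open>b\<close> gives \<open>1 = a u + b v\<close> where
  \<open>u\<close> and \<open>v\<close> multiply both \<open>a\<close> and \<open>b\<close> into \<open>\<oo>\<close>. One of \<open>a u\<close> and \<open>b v\<close> is not in \<open>P\<close>; it is the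
  denominator of \<open>b/a = b u / a u\<close> or of \<open>a/b = a v / b v\<close>.
\<close>

lemma valuation_local_ring_at:
  fixes P :: "'a::idom set"
  assumes dd: "dedekind_domain TYPE('a)" and P: "maximalideal P class_ring"
  shows "valuation_subring (local_ring_at P)"
proof
  note PD = maximalideal_class_ringD[OF P]
  have z: "s \<noteq> 0" if "s \<notin> P" for s using that ideal_class_ringD[OF PD(1)] by auto
  fix x y :: "'a fract"
  show "x + y \<in> local_ring_at P" "x * y \<in> local_ring_at P"
    if xy: "x \<in> local_ring_at P" "y \<in> local_ring_at P"
  proof -
    obtain r s r' s' where x: "x = to_fract r / to_fract s" "s \<notin> P"
      and y: "y = to_fract r' / to_fract s'" "s' \<notin> P"
      using xy unfolding local_ring_at_def by blast
    have "s * s' \<notin> P" using PD(4) x y by auto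
    moreover have "x + y = to_fract (r * s' + r' * s) / to_fract (s * s')"
      using z[OF x(2)] z[OF y(2)] unfolding x y by (simp add: field_simps)
    moreover have "x * y = to_fract (r * r') / to_fract (s * s')"
      unfolding x y by simp
    ultimately show "x + y \<in> local_ring_at P" "x * y \<in> local_ring_at P"
      unfolding local_ring_at_def by blast+
  qed
  obtain a b where ab: "x = to_fract a / to_fract b" "b \<noteq> 0"
    by (cases x) (auto simp: Fract_conv_to_fract)
  define I where "I = {r * a + s * b | r s. True}"
  have I: "ideal I class_ring" unfolding ideal_class_ring_iff
  proof (intro conjI ballI allI)
    show "0 \<in> I" unfolding I_def by (auto intro: exI[of _ 0])
    show "u + v \<in> I" if uv: "u \<in> I" "v \<in> I" for u v
    proof -
      obtain r s r' s' where "u = r * a + s * b" "v = r' * a + s' * b"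
        using uv unfolding I_def by blast
      then have "u + v = (r + r') * a + (s + s') * b" by (simp add: algebra_simps)
      then show ?thesis unfolding I_def by blast
    qed
    show "c * u \<in> I" if uv: "u \<in> I" for c u
    proof -
      obtain r s where "u = r * a + s * b" using uv unfolding I_def by blast
      then have "c * u = (c * r) * a + (c * s) * b" by (simp add: algebra_simps)
      then show ?thesis unfolding I_def by blast
    qed
  qed
  have "0 * a + 1 * b \<in> I" unfolding I_def by blast
  then have bI: "b \<in> I" by simp
  have "1 * a + 0 * b \<in> I" unfolding I_def by blast
  then have aI: "a \<in> I" by simp
  let ?Y = "frac_inv (frac_of I)"
  have scale: "to_fract c * w \<in> ?Y" if "w \<in> ?Y" for c w
    using fract_module.subspace_scale[OF subspace_frac_inv that] .
  let ?L = "{to_fract a * u + to_fract b * v | u v. u \<in> ?Y \<and> v \<in> ?Y}"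
  have L: "fract_module.subspace ?L"
  proof (rule fract_module.subspaceI)
    have "0 = to_fract a * 0 + to_fract b * 0" by simp
    then show "0 \<in> ?L" using fract_module.subspace_0[OF subspace_frac_inv] by blast
    show "p + q \<in> ?L" if "p \<in> ?L" "q \<in> ?L" for p q
    proof -
      obtain u v u' v' where "p = to_fract a * u + to_fract b * v" "u \<in> ?Y" "v \<in> ?Y"
        "q = to_fract a * u' + to_fract b * v'" "u' \<in> ?Y" "v' \<in> ?Y" using \<open>p \<in> ?L\<close> \<open>q \<in> ?L\<close> by blast
      moreover from this have "p + q = to_fract a * (u + u') + to_fract b * (v + v')"
        by (simp add: algebra_simps)
      ultimately show ?thesis using fract_module.subspace_add[OF subspace_frac_inv] by blast
    qed
    show "to_fract c * p \<in> ?L" if "p \<in> ?L" for c p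
    proof -
      obtain u v where "p = to_fract a * u + to_fract b * v" "u \<in> ?Y" "v \<in> ?Y"
        using \<open>p \<in> ?L\<close> by blast
      moreover from this have
        "to_fract c * p = to_fract a * (to_fract c * u) + to_fract b * (to_fract c * v)"
        by (simp add: algebra_simps)
      ultimately show ?thesis using scale by blast
    qed
  qed
  have "frac_of I \<cdot>\<^sub>F ?Y \<subseteq> ?L"
  proof (rule frac_mult_leI[OF L])
    fix p w assume "p \<in> frac_of I" and w: "w \<in> ?Y"
    then obtain r s where "p = to_fract (r * a + s * b)" unfolding frac_of_def I_def by auto
    then have "p * w = to_fract a * (to_fract r * w) + to_fract b * (to_fract s * w)"
      by (simp add: algebra_simps)
    then show "p * w \<in> ?L" using scale[OF w] by blast
  qed
  moreover have "I \<noteq> {0}" using bI ab by auto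
  ultimately have "1 \<in> ?L" using one_in_frac_mult_inv[OF dd I] by blast
  then obtain u v where uv: "1 = to_fract a * u + to_fract b * v" "u \<in> ?Y" "v \<in> ?Y" by blast
  have aX: "to_fract a \<in> frac_of I" and bX: "to_fract b \<in> frac_of I"
    using aI bI unfolding frac_of_def by auto
  obtain p t where p: "u * to_fract a = to_fract p" and t: "u * to_fract b = to_fract t"
    using uv(2) aX bX unfolding frac_inv_def by blast
  obtain q t' where q: "v * to_fract b = to_fract q" and t': "v * to_fract a = to_fract t'"
    using uv(3) aX bX unfolding frac_inv_def by blast
  have "to_fract (p + q) = to_fract 1" using uv(1) p q by (simp add: mult.commute)
  then have "p + q = 1" by (simp only: to_fract_eq_iff)
  then have "p \<notin> P \<or> q \<notin> P" using PD(3) ideal_class_ringD[OF PD(1)] by metis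
  then show "x \<in> local_ring_at P \<or> inverse x \<in> local_ring_at P"
  proof
    assume pP: "p \<notin> P"
    have a0: "a \<noteq> 0" using p z[OF pP] by auto
    have "to_fract b * to_fract p = to_fract a * to_fract t"
      by (simp flip: p t add: mult_ac)
    then have "inverse x = to_fract t / to_fract p"
      using ab z[OF pP] a0 by (simp add: frac_eq_eq mult.commute)
    then show ?thesis using pP unfolding local_ring_at_def by blast
  next
    assume qP: "q \<notin> P"
    have "to_fract a * to_fract q = to_fract b * to_fract t'"
      by (simp flip: q t' add: mult_ac)
    then have "x = to_fract t' / to_fract q"
      using ab z[OF qP] by (simp add: frac_eq_eq mult.commute)
    then show ?thesis using qP unfolding local_ring_at_def by blast
  qed
qed

section \<open>Determinants and the Cauchy-Binet formula\<close>

text \<open>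
  Index functions replace matrices: selecting, permuting and repeating rows or columns is then
  composition of functions, and dimensions need no bookkeeping.
\<close>

definition fdet :: "nat \<Rightarrow> (nat \<Rightarrow> nat \<Rightarrow> 'b) \<Rightarrow> 'b::comm_ring_1" where
  "fdet n F = det (mat n n (\<lambda>(i, j). F i j))"

lemma fdet_cong:
  "(\<And>i j. i < n \<Longrightarrow> j < n \<Longrightarrow> F i j = G i j) \<Longrightarrow> fdet n F = fdet n G"
  unfolding fdet_def by (intro arg_cong[of _ _ det] cong_mat) auto

lemma fdet_transpose: "fdet n (\<lambda>i j. F j i) = fdet n F"
proof -
  have "mat n n (\<lambda>(i, j). F j i) = transpose_mat (mat n n (\<lambda>(i, j). F i j))"
    by (rule eq_matI) auto
  then show ?thesis unfolding fdet_def
    using det_transpose[of "mat n n (\<lambda>(i, j). F i j)" n] by simp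
qed

lemma fdet_leibniz:
  "fdet n F = (\<Sum>p | p permutes {..<n}. of_int (sign p) * (\<Prod>j<n. F (p j) j))"
proof -
  have "fdet n F = (\<Sum>p | p permutes {0..<n}. of_int (sign p) *
      (\<Prod>j<n. mat n n (\<lambda>(i, j). F i j) $$ (p j, j)))"
    unfolding fdet_def by (rule det_col) simp
  also have "\<dots> = (\<Sum>p | p permutes {..<n}. of_int (sign p) * (\<Prod>j<n. F (p j) j))"
  proof (rule sum.cong)
    fix p assume "p \<in> {p. p permutes {..<n}}"
    then have "p j < n" if "j < n" for j using that permutes_in_image[of p "{..<n}" j] by auto
    then show "of_int (sign p) * (\<Prod>j<n. mat n n (\<lambda>(i, j). F i j) $$ (p j, j)) =
      of_int (sign p) * (\<Prod>j<n. F (p j) j)" by simp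
  qed (simp add: atLeast0LessThan)
  finally show ?thesis .
qed

lemma fdet_permute_rows:
  assumes p: "p permutes {..<n}"
  shows "fdet n (\<lambda>i j. F (p i) j) = of_int (sign p) * fdet n F"
proof -
  have "p i < n" if "i < n" for i using that permutes_in_image[OF p, of i] by auto
  then have "mat n n (\<lambda>(i, j). F (p i) j) =
      mat n n (\<lambda>(i, j). mat n n (\<lambda>(i, j). F i j) $$ (p i, j))"
    by (intro cong_mat) auto
  then show ?thesis unfolding fdet_def
    using det_permute_rows[of "mat n n (\<lambda>(i, j). F i j)" n p] p
    by (simp add: atLeast0LessThan)
qed

lemma fdet_permute_cols:
  assumes p: "p permutes {..<n}"
  shows "fdet n (\<lambda>i j. F i (p j)) = of_int (sign p) * fdet n F"
proof -
  have "fdet n (\<lambda>i j. F i (p j)) = fdet n (\<lambda>i j. F j (p i))"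
    using fdet_transpose[of n "\<lambda>i j. F i (p j)"] by simp
  also have "\<dots> = of_int (sign p) * fdet n (\<lambda>i j. F j i)"
    using fdet_permute_rows[OF p, of "\<lambda>i j. F j i"] .
  finally show ?thesis using fdet_transpose[of n F] by simp
qed

lemma fdet_equal_cols:
  assumes "a < n" "b < n" "a \<noteq> b" and eq: "\<And>i. i < n \<Longrightarrow> F i a = F i b"
  shows "fdet n F = 0"
  unfolding fdet_def
proof (rule det_identical_columns[of _ n a b])
  show "col (mat n n (\<lambda>(i, j). F i j)) a = col (mat n n (\<lambda>(i, j). F i j)) b"
    by (rule eq_vecI) (use assms in auto)
qed (use assms in auto)

lemma fdet_equal_rows:
  assumes "a < n" "b < n" "a \<noteq> b" and eq: "\<And>j. j < n \<Longrightarrow> F a j = F b j"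
  shows "fdet n F = 0"
  using fdet_equal_cols[of a n b "\<lambda>i j. F j i"] assms fdet_transpose[of n F] by simp

lemma fdet_col_sum:
  fixes F :: "nat \<Rightarrow> nat \<Rightarrow> 'b::comm_ring_1"
  assumes a: "a < n" and S: "finite S"
  shows "fdet n (\<lambda>i j. if j = a then \<Sum>l\<in>S. x l * G l i else F i j) =
    (\<Sum>l\<in>S. x l * fdet n (\<lambda>i j. if j = a then G l i else F i j))"
proof -
  have split: "(\<Prod>j<n. if j = a then u j else v j) = u a * (\<Prod>j\<in>{..<n} - {a}. v j)"
    for u v :: "nat \<Rightarrow> 'b"
  proof -
    have "(\<Prod>j<n. if j = a then u j else v j) =
        u a * (\<Prod>j\<in>{..<n} - {a}. if j = a then u j else v j)"
      using a by (subst prod.remove[of _ a]) auto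
    also have "(\<Prod>j\<in>{..<n} - {a}. if j = a then u j else v j) = (\<Prod>j\<in>{..<n} - {a}. v j)"
      by (rule prod.cong) auto
    finally show ?thesis .
  qed
  have "fdet n (\<lambda>i j. if j = a then \<Sum>l\<in>S. x l * G l i else F i j) =
     (\<Sum>p | p permutes {..<n}. \<Sum>l\<in>S. of_int (sign p) *
        (x l * G l (p a) * (\<Prod>j\<in>{..<n} - {a}. F (p j) j)))"
    unfolding fdet_leibniz split by (simp only: sum_distrib_left sum_distrib_right)
  also have "\<dots> = (\<Sum>l\<in>S. \<Sum>p | p permutes {..<n}. of_int (sign p) *
        (x l * G l (p a) * (\<Prod>j\<in>{..<n} - {a}. F (p j) j)))"
    by (rule sum.swap)
  also have "\<dots> = (\<Sum>l\<in>S. x l * fdet n (\<lambda>i j. if j = a then G l i else F i j))"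
    unfolding fdet_leibniz split by (simp add: sum_distrib_left mult_ac)
  finally show ?thesis .
qed

lemma fdet_mult:
  "fdet n (\<lambda>i j. \<Sum>l<n. P i l * Q l j) = fdet n P * fdet n Q"
proof -
  have "mat n n (\<lambda>(i, j). \<Sum>l<n. P i l * Q l j) =
      mat n n (\<lambda>(i, j). P i j) * mat n n (\<lambda>(i, j). Q i j)"
    by (rule eq_matI) (auto simp: scalar_prod_def atLeast0LessThan)
  then show ?thesis unfolding fdet_def by (simp add: det_mult[of _ n])
qed

lemma fdet_expand_product:
  "fdet k (\<lambda>i j. \<Sum>l<n::nat. P i l * Q l j) =
    (\<Sum>f\<in>{..<k} \<rightarrow>\<^sub>E {..<n}. (\<Prod>j<k. Q (f j) j) * fdet k (\<lambda>i j. P i (f j)))"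
proof -
  let ?E = "{..<k} \<rightarrow>\<^sub>E {..<n}"
  have "fdet k (\<lambda>i j. \<Sum>l<n. P i l * Q l j) =
      (\<Sum>p | p permutes {..<k}. \<Sum>f\<in>?E.
        of_int (sign p) * (\<Prod>j<k. P (p j) (f j) * Q (f j) j))"
    unfolding fdet_leibniz by (subst prod_sum_PiE) (auto simp: sum_distrib_left)
  also have "\<dots> = (\<Sum>f\<in>?E. \<Sum>p | p permutes {..<k}.
        of_int (sign p) * (\<Prod>j<k. P (p j) (f j) * Q (f j) j))"
    by (rule sum.swap)
  also have "\<dots> = (\<Sum>f\<in>?E. (\<Prod>j<k. Q (f j) j) * fdet k (\<lambda>i j. P i (f j)))"
    unfolding fdet_leibniz by (simp add: sum_distrib_left prod.distrib mult_ac)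
  finally show ?thesis .
qed

lemma extend_to_permutation:
  assumes inj: "inj_on h S" and S: "S \<subseteq> {..<n::nat}" and hS: "h ` S \<subseteq> {..<n}"
  obtains p where "p permutes {..<n}" "\<And>x. x \<in> S \<Longrightarrow> p x = h x"
proof -
  have fin: "finite S" using S finite_subset by blast
  have "card ({..<n} - S) = card ({..<n} - h ` S)"
    using S hS fin inj by (simp add: card_Diff_subset card_image)
  then obtain g where g: "bij_betw g ({..<n} - S) ({..<n} - h ` S)"
    using finite_same_card_bij[of "{..<n} - S" "{..<n} - h ` S"] by auto
  define p where "p x = (if x \<in> S then h x else if x < n then g x else x)" for x
  have "bij_betw p S (h ` S)"
    using inj unfolding bij_betw_def p_def by (auto simp: inj_on_def)
  moreover have "bij_betw p ({..<n} - S) ({..<n} - h ` S)"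
    using g by (rule bij_betw_cong[THEN iffD1, rotated]) (auto simp: p_def)
  ultimately have "bij_betw p (S \<union> ({..<n} - S)) (h ` S \<union> ({..<n} - h ` S))"
    by (rule bij_betw_combine) auto
  then have "bij_betw p {..<n} {..<n}" using S hS by (simp add: Un_absorb1)
  then have "p permutes {..<n}" by (rule bij_imp_permutes) (use S in \<open>auto simp: p_def\<close>)
  then show ?thesis by (rule that) (simp add: p_def)
qed

lemma permutation_between_enumerations:
  assumes r: "bij_betw r {..<k::nat} S" and e: "bij_betw e {..<k} S"
  obtains p where "p permutes {..<k}" "\<And>i. i < k \<Longrightarrow> r i = e (p i)"
proof -
  let ?h = "\<lambda>i. inv_into {..<k} e (r i)"
  have inv: "bij_betw (inv_into {..<k} e) S {..<k}" by (rule bij_betw_inv_into[OF e])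
  have "bij_betw ?h {..<k} {..<k}" using bij_betw_trans[OF r inv] by (simp add: o_def)
  then have "inj_on ?h {..<k}" "?h ` {..<k} \<subseteq> {..<k}" unfolding bij_betw_def by auto
  then obtain p where p: "p permutes {..<k}" "\<And>i. i \<in> {..<k} \<Longrightarrow> p i = ?h i"
    using extend_to_permutation[of ?h "{..<k}" k] by blast
  show ?thesis
  proof (rule that[OF p(1)])
    fix i assume i: "i < k"
    then have "r i \<in> e ` {..<k}" using r e unfolding bij_betw_def by auto
    then show "r i = e (p i)" using p(2)[of i] i by (simp add: f_inv_into_f)
  qed
qed

text \<open>
  Expanding by columns gives a sum over all functions \<open>f\<close> from \<open>{..<k}\<close> to \<open>{..<n}\<close>. Non-injective
  ones contribute \<open>0\<close>, and the injective ones with image \<open>S\<close> are the compositions of one enumeration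
  \<open>e S\<close> of \<open>S\<close> with the permutations of \<open>{..<k}\<close>; these assemble the minor of \<open>Q\<close> on the rows \<open>S\<close>.
\<close>

lemma cauchy_binet:
  assumes e: "\<And>S. S \<subseteq> {..<n::nat} \<Longrightarrow> card S = k \<Longrightarrow> bij_betw (e S) {..<k} S"
  shows "fdet k (\<lambda>i j. \<Sum>l<n. P i l * Q l j) =
    (\<Sum>S | S \<subseteq> {..<n} \<and> card S = k.
      fdet k (\<lambda>i j. P i (e S j)) * fdet k (\<lambda>i j. Q (e S i) j))"
proof -
  let ?E = "{..<k} \<rightarrow>\<^sub>E {..<n}"
  let ?I = "{f \<in> ?E. inj_on f {..<k}}"
  let ?SS = "{S. S \<subseteq> {..<n} \<and> card S = k}"
  let ?t = "\<lambda>f. (\<Prod>j<k. Q (f j) j) * fdet k (\<lambda>i j. P i (f j))"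
  have finE: "finite ?E" by (intro finite_PiE) auto
  have "fdet k (\<lambda>i j. \<Sum>l<n. P i l * Q l j) = sum ?t ?E" by (rule fdet_expand_product)
  also have "\<dots> = sum ?t ?I"
  proof (rule sum.mono_neutral_right[OF finE])
    show "\<forall>f\<in>?E - ?I. ?t f = 0"
    proof
      fix f assume "f \<in> ?E - ?I"
      then obtain a b where "a < k" "b < k" "a \<noteq> b" "f a = f b" unfolding inj_on_def by auto
      then have "fdet k (\<lambda>i j. P i (f j)) = 0" by (intro fdet_equal_cols[of a k b]) auto
      then show "?t f = 0" by simp
    qed
  qed auto
  also have "\<dots> = (\<Sum>S\<in>?SS. \<Sum>f\<in>{f \<in> ?I. f ` {..<k} = S}. ?t f)"
  proof (rule sum.group[symmetric])
    show "finite ?I" using finE by simp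
    show "finite ?SS" by simp
    have "f ` {..<k} \<in> ?SS" if "f \<in> ?I" for f
    proof -
      have f: "f \<in> ?E" "inj_on f {..<k}" using that by simp_all
      then have "f ` {..<k} \<subseteq> {..<n}" using PiE_mem[OF f(1)] by (simp add: image_subset_iff)
      then show ?thesis using card_image[OF f(2)] by simp
    qed
    then show "(\<lambda>f. f ` {..<k}) ` ?I \<subseteq> ?SS" by blast
  qed
  also have "\<dots> = (\<Sum>S\<in>?SS. fdet k (\<lambda>i j. P i (e S j)) * fdet k (\<lambda>i j. Q (e S i) j))"
  proof (rule sum.cong[OF refl])
    fix S assume "S \<in> ?SS"
    then have S: "S \<subseteq> {..<n}" "card S = k" by auto
    note eS = e[OF S]
    let ?to = "\<lambda>p. restrict (\<lambda>j. e S (p j)) {..<k}"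
    have bij: "bij_betw ?to {p. p permutes {..<k}} {f \<in> ?I. f ` {..<k} = S}"
    proof (rule bij_betw_imageI)
      show "inj_on ?to {p. p permutes {..<k}}"
      proof (rule inj_onI)
        fix p q assume p: "p \<in> {p. p permutes {..<k}}" and q: "q \<in> {p. p permutes {..<k}}"
          and eq: "?to p = ?to q"
        show "p = q"
        proof
          fix j
          show "p j = q j"
          proof (cases "j < k")
            case True
            then have "e S (p j) = e S (q j)" using fun_cong[OF eq, of j] by simp
            moreover have "p j < k" "q j < k"
              using p q True permutes_in_image[of _ "{..<k}" j] by auto
            ultimately show ?thesis using eS unfolding bij_betw_def inj_on_def by auto
          next
            case False
            then show ?thesis using p q permutes_not_in[of p "{..<k}" j] permutes_not_in[of q "{..<k}" j]
              by simp
          qed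
        qed
      qed
      show "?to ` {p. p permutes {..<k}} = {f \<in> ?I. f ` {..<k} = S}"
      proof (intro equalityI subsetI)
        fix f assume "f \<in> ?to ` {p. p permutes {..<k}}"
        then obtain p where p: "p permutes {..<k}" and f: "f = ?to p" by auto
        have bf: "bij_betw f {..<k} S"
          using bij_betw_trans[OF permutes_imp_bij[OF p] eS]
          by (rule bij_betw_cong[THEN iffD1, rotated]) (simp add: f)
        moreover have "f j \<in> {..<n}" if "j < k" for j
          using bf S(1) that unfolding bij_betw_def by blast
        then have "f \<in> ?E" unfolding f by auto
        ultimately show "f \<in> {f \<in> ?I. f ` {..<k} = S}" unfolding bij_betw_def by auto
      next
        fix f assume f: "f \<in> {f \<in> ?I. f ` {..<k} = S}"
        then have "bij_betw f {..<k} S" unfolding bij_betw_def by auto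
        then obtain p where p: "p permutes {..<k}" "\<And>j. j < k \<Longrightarrow> f j = e S (p j)"
          using permutation_between_enumerations[OF _ eS] by blast
        have "f = ?to p"
        proof
          show "f j = ?to p j" for j using f p(2)[of j] by (auto simp: PiE_def extensional_def)
        qed
        then show "f \<in> ?to ` {p. p permutes {..<k}}" using p(1) by auto
      qed
    qed
    have "(\<Sum>f\<in>{f \<in> ?I. f ` {..<k} = S}. ?t f) = (\<Sum>p | p permutes {..<k}. ?t (?to p))"
      by (rule sum.reindex_bij_betw[OF bij, symmetric])
    also have "\<dots> = (\<Sum>p | p permutes {..<k}. fdet k (\<lambda>i j. P i (e S j)) *
        (of_int (sign p) * (\<Prod>j<k. Q (e S (p j)) j)))"
    proof (rule sum.cong[OF refl])
      fix p assume "p \<in> {p. p permutes {..<k}}"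
      then have p: "p permutes {..<k}" by simp
      have "fdet k (\<lambda>i j. P i (?to p j)) = fdet k (\<lambda>i j. P i (e S (p j)))"
        by (rule fdet_cong) simp
      also have "\<dots> = of_int (sign p) * fdet k (\<lambda>i j. P i (e S j))"
        using fdet_permute_cols[OF p, of "\<lambda>i j. P i (e S j)"] .
      finally show "?t (?to p) = fdet k (\<lambda>i j. P i (e S j)) *
          (of_int (sign p) * (\<Prod>j<k. Q (e S (p j)) j))" by (simp add: mult_ac)
    qed
    also have "\<dots> = fdet k (\<lambda>i j. P i (e S j)) * fdet k (\<lambda>i j. Q (e S i) j)"
      unfolding fdet_leibniz[of k "\<lambda>i j. Q (e S i) j"] by (simp only: sum_distrib_left)
    finally show "(\<Sum>f\<in>{f \<in> ?I. f ` {..<k} = S}. ?t f) =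
      fdet k (\<lambda>i j. P i (e S j)) * fdet k (\<lambda>i j. Q (e S i) j)" .
  qed
  finally show ?thesis .
qed

text \<open>
  Permuting the rows by \<open>p\<close> turns the unit columns into those of an identity block, with zeros
  above it.
\<close>

lemma fdet_unit_columns:
  fixes M :: "nat \<Rightarrow> nat \<Rightarrow> 'b::idom"
  assumes k: "k \<le> n" and p: "p permutes {..<n}"
  shows "fdet n (\<lambda>i j. if j < k then M i j else if i = p j then 1 else 0) =
    of_int (sign p) * fdet k (\<lambda>i j. M (p i) j)"
proof -
  let ?F = "\<lambda>i j. if j < k then M i j else if i = p j then 1 else 0"
  let ?m = "n - k"
  let ?A = "mat k k (\<lambda>(i, j). M (p i) j)" and ?C = "mat ?m k (\<lambda>(i, j). M (p (i + k)) j)"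
  have pinj: "p i = p j \<longleftrightarrow> i = j" for i j using permutes_inj[OF p] by (auto dest: injD)
  have "mat n n (\<lambda>(i, j). ?F (p i) j) = four_block_mat ?A (0\<^sub>m k ?m) ?C (1\<^sub>m ?m)"
    by (rule eq_matI) (use k in \<open>auto simp: pinj\<close>)
  then have "fdet n (\<lambda>i j. ?F (p i) j) = det ?A * det (1\<^sub>m ?m :: 'b mat)"
    unfolding fdet_def
    using det_four_block_mat_upper_right_zero[of ?A k "0\<^sub>m k ?m" ?m ?C "1\<^sub>m ?m"] by simp
  then have "of_int (sign p) * fdet n ?F = fdet k (\<lambda>i j. M (p i) j)"
    using fdet_permute_rows[OF p, of ?F] unfolding fdet_def by simp
  then have "of_int (sign p) * (of_int (sign p) * fdet n ?F) =
      of_int (sign p) * fdet k (\<lambda>i j. M (p i) j)" by simp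
  moreover have "of_int (sign p) * (of_int (sign p) * fdet n ?F) = fdet n ?F"
    by (cases p rule: sign_cases) auto
  ultimately show ?thesis by simp
qed

section \<open>Minors as maximal minors of an augmented matrix\<close>

text \<open>
  The index functions are arbitrary. Repeated indices only add \<open>0\<close>, and a different order of the
  indices only changes the sign, so the span is that of the minors on increasing indices.
\<close>

definition minors :: "nat \<Rightarrow> nat \<Rightarrow> (nat \<Rightarrow> nat \<Rightarrow> 'b) \<Rightarrow> 'b::comm_ring_1 set" where
  "minors k n M = {fdet k (\<lambda>i j. M (r i) (c j)) | r c.
     r \<in> {..<k} \<rightarrow> {..<n} \<and> c \<in> {..<k} \<rightarrow> {..<n}}"

definition signed_minors :: "nat \<Rightarrow> nat \<Rightarrow> (nat \<Rightarrow> nat \<Rightarrow> 'b) \<Rightarrow> 'b::comm_ring_1 set" where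
  "signed_minors k n M = {x. x = 0 \<or> x \<in> minors k n M \<or> - x \<in> minors k n M}"

text \<open>
  The \<open>n \<times> 2n\<close> matrix \<open>(M | 1)\<close>. Its maximal minors are, up to sign, the minors of all sizes of \<open>M\<close>,
  the size being the number of columns taken from \<open>M\<close> (called \<open>weight\<close> below).
\<close>

definition augment :: "nat \<Rightarrow> (nat \<Rightarrow> nat \<Rightarrow> 'b) \<Rightarrow> nat \<Rightarrow> nat \<Rightarrow> 'b::comm_ring_1" where
  "augment n M i j = (if j < n then M i j else if i = j - n then 1 else 0)"

definition weight :: "nat \<Rightarrow> (nat \<Rightarrow> nat) \<Rightarrow> nat" where
  "weight n f = card {j \<in> {..<n}. f j < n}"

definition maximal_minor :: "nat \<Rightarrow> (nat \<Rightarrow> nat \<Rightarrow> 'b) \<Rightarrow> (nat \<Rightarrow> nat) \<Rightarrow> 'b::comm_ring_1" where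
  "maximal_minor n M f = fdet n (\<lambda>i j. augment n M i (f j))"

lemma minorsI:
  "r \<in> {..<k} \<rightarrow> {..<n} \<Longrightarrow> c \<in> {..<k} \<rightarrow> {..<n} \<Longrightarrow>
    fdet k (\<lambda>i j. M (r i) (c j)) \<in> minors k n M"
  unfolding minors_def by blast

lemma fdet_nonzero_inj_rows:
  assumes "fdet k (\<lambda>i j. M (r i) j) \<noteq> 0"
  shows "inj_on r {..<k}"
proof (rule inj_onI, rule ccontr)
  fix a b assume "a \<in> {..<k}" "b \<in> {..<k}" "r a = r b" "a \<noteq> b"
  then have "fdet k (\<lambda>i j. M (r i) j) = 0" by (intro fdet_equal_rows[of a k b]) auto
  then show False using assms by simp
qed

lemma fdet_nonzero_inj_cols:
  assumes "fdet k (\<lambda>i j. M i (c j)) \<noteq> 0"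
  shows "inj_on c {..<k}"
proof (rule inj_onI, rule ccontr)
  fix a b assume "a \<in> {..<k}" "b \<in> {..<k}" "c a = c b" "a \<noteq> b"
  then have "fdet k (\<lambda>i j. M i (c j)) = 0" by (intro fdet_equal_cols[of a k b]) auto
  then show False using assms by simp
qed

lemma sign_times_signed_minor:
  assumes "of_int (sign p) * x \<in> signed_minors k n M"
  shows "x \<in> signed_minors k n M"
  using assms by (cases p rule: sign_cases) (auto simp: signed_minors_def)

text \<open>
  The rows \<open>r\<close> of a nonzero minor are distinct; extend them to a permutation \<open>p\<close> and fill up the
  chosen columns with the unit vectors at the positions \<open>p k, \<dots>, p (n - 1)\<close>.
\<close>

lemma minor_as_maximal_minor:
  fixes M :: "nat \<Rightarrow> nat \<Rightarrow> 'b::idom"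
  assumes m: "m \<in> minors k n M" "m \<noteq> 0" and k: "k \<le> n"
  obtains f where "f \<in> {..<n} \<rightarrow>\<^sub>E {..<2 * n}" "weight n f = k"
    "maximal_minor n M f = m \<or> maximal_minor n M f = - m"
proof -
  obtain r c where r: "r \<in> {..<k} \<rightarrow> {..<n}" and c: "c \<in> {..<k} \<rightarrow> {..<n}"
    and m_eq: "m = fdet k (\<lambda>i j. M (r i) (c j))" using m(1) unfolding minors_def by blast
  have "inj_on r {..<k}"
    using fdet_nonzero_inj_rows[of k "\<lambda>i j. M i (c j)" r] m(2) m_eq by simp
  moreover have "{..<k} \<subseteq> {..<n}" using k by auto
  moreover have "r ` {..<k} \<subseteq> {..<n}" using r by auto
  ultimately obtain p where p: "p permutes {..<n}" and pr: "\<And>i. i \<in> {..<k} \<Longrightarrow> p i = r i"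
    by (rule extend_to_permutation) blast
  define f where "f = restrict (\<lambda>j. if j < k then c j else n + p j) {..<n}"
  have cn: "c j < n" if "j < k" for j using c that by auto
  have pn: "p j < n" if "j < n" for j using permutes_in_image[OF p, of j] that by auto
  have "(if j < k then c j else n + p j) < 2 * n" if "j < n" for j
    using cn[of j] pn[OF that] that by auto
  then have fE: "f \<in> {..<n} \<rightarrow>\<^sub>E {..<2 * n}" unfolding f_def by (simp add: restrict_PiE_iff)
  have "{j \<in> {..<n}. f j < n} = {..<k}" unfolding f_def using cn k by auto
  then have w: "weight n f = k" unfolding weight_def by simp
  have "maximal_minor n M f = fdet n (\<lambda>i j. if j < k then M i (c j) else if i = p j then 1 else 0)"
    unfolding maximal_minor_def by (rule fdet_cong) (auto simp: f_def augment_def cn)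
  also have "\<dots> = of_int (sign p) * fdet k (\<lambda>i j. M (p i) (c j))"
    by (rule fdet_unit_columns[OF k p])
  also have "fdet k (\<lambda>i j. M (p i) (c j)) = m"
    unfolding m_eq by (rule fdet_cong) (simp add: pr)
  finally have "maximal_minor n M f = m \<or> maximal_minor n M f = - m"
    by (cases p rule: sign_cases) auto
  then show ?thesis using that fE w by blast
qed

text \<open>
  After a permutation \<open>s\<close> of the selected columns, those taken from \<open>M\<close> come first. The unit
  columns after them are distinct, so that their positions extend to a permutation \<open>p\<close> of the rows.
\<close>

lemma maximal_minor_as_minor:
  fixes M :: "nat \<Rightarrow> nat \<Rightarrow> 'b::idom"
  assumes f: "f \<in> {..<n} \<rightarrow> {..<2 * n}"
  shows "maximal_minor n M f \<in> signed_minors (weight n f) n M"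
proof (cases "maximal_minor n M f = 0")
  case True
  then show ?thesis unfolding signed_minors_def by simp
next
  case False
  then have inj: "inj_on f {..<n}"
    unfolding maximal_minor_def by (rule fdet_nonzero_inj_cols)
  define k where "k = weight n f"
  define S where "S = {j \<in> {..<n}. f j < n}"
  have S: "S \<subseteq> {..<n}" "finite S" "card S = k" unfolding S_def k_def weight_def by auto
  have k: "k \<le> n" using card_mono[OF _ S(1)] S(3) by simp
  obtain h where h: "bij_betw h {..<k} S"
    using ex_bij_betw_nat_finite[OF S(2)] S(3) by (auto simp: atLeast0LessThan)
  have "inj_on h {..<k}" "{..<k} \<subseteq> {..<n}" "h ` {..<k} \<subseteq> {..<n}"
    using h S(1) k unfolding bij_betw_def by auto
  then obtain s where s: "s permutes {..<n}" and sh: "\<And>j. j \<in> {..<k} \<Longrightarrow> s j = h j"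
    by (rule extend_to_permutation) blast
  have sn: "s j < n" if "j < n" for j using permutes_in_image[OF s, of j] that by auto
  have sS: "s j \<in> S \<longleftrightarrow> j < k" if "j < n" for j
  proof
    assume "s j \<in> S"
    then obtain i where i: "i < k" "s j = h i" using h unfolding bij_betw_def by auto
    then have "s j = s i" using sh by simp
    then have "j = i" using permutes_inj[OF s] by (auto dest: injD)
    then show "j < k" using i by simp
  next
    assume "j < k"
    then show "s j \<in> S" using sh h unfolding bij_betw_def by auto
  qed
  have fs: "f (s j) < n \<longleftrightarrow> j < k" if "j < n" for j
    using sS[OF that] sn[OF that] unfolding S_def by simp
  have f2: "f (s j) < 2 * n" if "j < n" for j using f sn[OF that] by auto
  define u where "u j = f (s j) - n" for j
  have "inj_on u {k..<n}"
  proof (rule inj_onI)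
    fix i j assume ij: "i \<in> {k..<n}" "j \<in> {k..<n}" "u i = u j"
    then have "f (s i) = f (s j)" using fs[of i] fs[of j] unfolding u_def by auto
    then have "s i = s j" using inj sn ij(1,2) by (auto dest: inj_onD)
    then show "i = j" using permutes_inj[OF s] by (auto dest: injD)
  qed
  moreover have "{k..<n} \<subseteq> {..<n}" by auto
  moreover have "u ` {k..<n} \<subseteq> {..<n}" using f2 fs unfolding u_def by fastforce
  ultimately obtain p where p: "p permutes {..<n}" and pu: "\<And>j. j \<in> {k..<n} \<Longrightarrow> p j = u j"
    by (rule extend_to_permutation) blast
  have pn: "p j < n" if "j < n" for j using permutes_in_image[OF p, of j] that by auto
  have "of_int (sign s) * maximal_minor n M f = fdet n (\<lambda>i j. augment n M i (f (s j)))"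
    unfolding maximal_minor_def
    using fdet_permute_cols[OF s, of "\<lambda>i j. augment n M i (f j)"] by simp
  also have "\<dots> = fdet n (\<lambda>i j. if j < k then M i (f (s j)) else if i = p j then 1 else 0)"
    by (rule fdet_cong) (use fs pu in \<open>auto simp: augment_def u_def\<close>)
  also have "\<dots> = of_int (sign p) * fdet k (\<lambda>i j. M (p i) (f (s j)))"
    by (rule fdet_unit_columns[OF k p])
  finally have eq: "of_int (sign s) * maximal_minor n M f =
      of_int (sign p) * fdet k (\<lambda>i j. M (p i) (f (s j)))" .
  have "fdet k (\<lambda>i j. M (p i) (f (s j))) \<in> minors k n M"
    by (rule minorsI[of p k n "\<lambda>j. f (s j)" M]) (use pn fs k in auto)
  then have "of_int (sign s) * maximal_minor n M f \<in> signed_minors k n M"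
    unfolding eq by (cases p rule: sign_cases) (auto simp: signed_minors_def)
  then show ?thesis unfolding k_def by (rule sign_times_signed_minor)
qed

lemma fdet_inverse:
  fixes P :: "nat \<Rightarrow> nat \<Rightarrow> 'k::field"
  assumes nz: "fdet n P \<noteq> 0"
  obtains H where
    "\<And>i j. i < n \<Longrightarrow> j < n \<Longrightarrow> (\<Sum>l<n. P i l * H l j) = (if i = j then 1 else 0)"
    "\<And>i j. i < n \<Longrightarrow> j < n \<Longrightarrow> (\<Sum>l<n. H i l * P l j) = (if i = j then 1 else 0)"
proof -
  let ?A = "mat n n (\<lambda>(i, j). P i j)"
  let ?d = "fdet n P"
  have A: "?A \<in> carrier_mat n n" by simp
  note adj = adj_mat[OF A]
  define H where "H i j = inverse ?d * adj_mat ?A $$ (i, j)" for i j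
  have d: "det ?A = ?d" unfolding fdet_def by simp
  show ?thesis
  proof (rule that[of H])
    fix i j assume ij: "i < n" "j < n"
    have "(?A * adj_mat ?A) $$ (i, j) = (\<Sum>l<n. P i l * adj_mat ?A $$ (l, j))"
      using ij adj(1) by (auto simp: scalar_prod_def atLeast0LessThan intro!: sum.cong)
    moreover have "(?A * adj_mat ?A) $$ (i, j) = (if i = j then ?d else 0)"
      unfolding adj(2) d using ij by simp
    ultimately have "(\<Sum>l<n. P i l * adj_mat ?A $$ (l, j)) = (if i = j then ?d else 0)" by simp
    then show "(\<Sum>l<n. P i l * H l j) = (if i = j then 1 else 0)"
      unfolding H_def using nz by (simp add: mult.left_commute[of _ "inverse ?d"] flip: sum_distrib_left)
    have "(adj_mat ?A * ?A) $$ (i, j) = (\<Sum>l<n. adj_mat ?A $$ (i, l) * P l j)"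
      using ij adj(1) by (auto simp: scalar_prod_def atLeast0LessThan intro!: sum.cong)
    moreover have "(adj_mat ?A * ?A) $$ (i, j) = (if i = j then ?d else 0)"
      unfolding adj(3) d using ij by simp
    ultimately have "(\<Sum>l<n. adj_mat ?A $$ (i, l) * P l j) = (if i = j then ?d else 0)" by simp
    then show "(\<Sum>l<n. H i l * P l j) = (if i = j then 1 else 0)"
      unfolding H_def using nz by (simp add: mult.assoc flip: sum_distrib_left)
  qed
qed

text \<open>
  Jacobi's complementary minor formula, up to sign. Write the minor of \<open>H = P\<inverse>\<close> as the determinant
  of a matrix consisting of \<open>k\<close> columns of \<open>H\<close> and \<open>n - k\<close> unit columns. Multiplication by \<open>P\<close> turns
  the former into unit columns and the latter into columns of \<open>P\<close>.
\<close>

lemma minor_of_inverse: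
  fixes P H :: "nat \<Rightarrow> nat \<Rightarrow> 'k::idom"
  assumes PH: "\<And>i j. i < n \<Longrightarrow> j < n \<Longrightarrow> (\<Sum>l<n. P i l * H l j) = (if i = j then 1 else 0)"
    and m: "m \<in> minors k n H" and k: "k \<le> n"
  shows "fdet n P * m \<in> signed_minors (n - k) n P"
proof (cases "m = 0")
  case True
  then show ?thesis unfolding signed_minors_def by simp
next
  case False
  obtain r c where r: "r \<in> {..<k} \<rightarrow> {..<n}" and c: "c \<in> {..<k} \<rightarrow> {..<n}"
    and m_eq: "m = fdet k (\<lambda>i j. H (r i) (c j))" using m unfolding minors_def by blast
  have "inj_on r {..<k}"
    using fdet_nonzero_inj_rows[of k "\<lambda>i j. H i (c j)" r] False m_eq by simp
  moreover have "{..<k} \<subseteq> {..<n}" using k by auto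
  moreover have "r ` {..<k} \<subseteq> {..<n}" using r by auto
  ultimately obtain p where p: "p permutes {..<n}" and pr: "\<And>i. i \<in> {..<k} \<Longrightarrow> p i = r i"
    by (rule extend_to_permutation) blast
  have cn: "c j < n" if "j < k" for j using c that by auto
  have pn: "p j < n" if "j < n" for j using permutes_in_image[OF p, of j] that by auto
  let ?Q = "\<lambda>i j. if j < k then H i (c j) else if i = p j then 1 else 0"
  define f where "f j = (if j < k then n + c j else p j)" for j
  have "fdet k (\<lambda>i j. H (p i) (c j)) = m"
    unfolding m_eq by (rule fdet_cong) (simp add: pr)
  then have "of_int (sign p) * (fdet n P * m) = fdet n P * fdet n ?Q"
    using fdet_unit_columns[OF k p, of "\<lambda>i j. H i (c j)"] by simp
  also have "\<dots> = fdet n (\<lambda>i j. \<Sum>l<n. P i l * ?Q l j)" by (rule fdet_mult[symmetric])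
  also have "\<dots> = maximal_minor n P f"
    unfolding maximal_minor_def
  proof (rule fdet_cong)
    fix i j assume ij: "i < n" "j < n"
    show "(\<Sum>l<n. P i l * ?Q l j) = augment n P i (f j)"
    proof (cases "j < k")
      case True
      then show ?thesis using PH[OF ij(1) cn[OF True]] by (simp add: augment_def f_def)
    next
      case False
      then show ?thesis using pn[OF ij(2)]
        by (simp add: augment_def f_def if_distrib[of "(*) _"] cong: if_cong)
    qed
  qed
  finally have eq: "of_int (sign p) * (fdet n P * m) = maximal_minor n P f" .
  have "f j < n \<longleftrightarrow> k \<le> j" if "j < n" for j unfolding f_def using pn[OF that] by simp
  then have "{j \<in> {..<n}. f j < n} = {k..<n}" by auto
  then have w: "weight n f = n - k" unfolding weight_def by simp
  have "f j < 2 * n" if "j < n" for j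
    unfolding f_def using cn[of j] pn[OF that] that by auto
  then have "f \<in> {..<n} \<rightarrow> {..<2 * n}" by simp
  from maximal_minor_as_minor[OF this, of P]
  have "of_int (sign p) * (fdet n P * m) \<in> signed_minors (n - k) n P" unfolding w eq .
  then show ?thesis by (rule sign_times_signed_minor)
qed

text \<open>
  A Pluecker relation. By Cramer's rule the column \<open>f a\<close> is the combination of the columns
  \<open>g 0, \<dots>, g (n - 1)\<close> whose \<open>j\<close>-th coefficient is the ratio of the minors for \<open>g(j := f a)\<close> and \<open>g\<close>;
  substitute this combination for the column \<open>f a\<close> in the first factor.
\<close>

lemma maximal_minor_exchange:
  fixes M :: "nat \<Rightarrow> nat \<Rightarrow> 'k::field"
  assumes a: "a < n" and nz: "maximal_minor n M g \<noteq> 0"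
  shows "maximal_minor n M f * maximal_minor n M g =
    (\<Sum>j<n. maximal_minor n M (f(a := g j)) * maximal_minor n M (g(j := f a)))"
proof -
  let ?N = "augment n M"
  let ?G = "\<lambda>i j. ?N i (g j)"
  obtain H where H: "\<And>i j. i < n \<Longrightarrow> j < n \<Longrightarrow>
      (\<Sum>l<n. ?G i l * H l j) = (if i = j then 1 else 0)"
    using fdet_inverse[OF nz[unfolded maximal_minor_def]] by metis
  define x where "x l = (\<Sum>t<n. H l t * ?N t (f a))" for l
  have x: "?N i (f a) = (\<Sum>l<n. x l * ?N i (g l))" if i: "i < n" for i
  proof -
    have "(\<Sum>l<n. x l * ?N i (g l)) = (\<Sum>l<n. \<Sum>t<n. ?G i l * H l t * ?N t (f a))"
      unfolding x_def by (simp add: sum_distrib_left mult_ac)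
    also have "\<dots> = (\<Sum>t<n. \<Sum>l<n. ?G i l * H l t * ?N t (f a))" by (rule sum.swap)
    also have "\<dots> = (\<Sum>t<n. (\<Sum>l<n. ?G i l * H l t) * ?N t (f a))"
      by (simp only: sum_distrib_right)
    also have "\<dots> = (\<Sum>t<n. (if i = t then 1 else 0) * ?N t (f a))"
      by (rule sum.cong) (use H i in auto)
    also have "\<dots> = ?N i (f a)"
      using i by (simp add: if_distrib[of "\<lambda>y. y * _"] cong: if_cong)
    finally show ?thesis by simp
  qed
  have col: "maximal_minor n M (h(b := f a)) = (\<Sum>l<n. x l * maximal_minor n M (h(b := g l)))"
    if b: "b < n" for h b
  proof -
    have "maximal_minor n M (h(b := f a)) =
        fdet n (\<lambda>i j. if j = b then \<Sum>l<n. x l * ?N i (g l) else ?N i (h j))"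
      unfolding maximal_minor_def by (rule fdet_cong) (auto simp: x)
    also have "\<dots> = (\<Sum>l<n. x l * fdet n (\<lambda>i j. if j = b then ?N i (g l) else ?N i (h j)))"
      by (rule fdet_col_sum[OF b]) simp
    also have "\<dots> = (\<Sum>l<n. x l * maximal_minor n M (h(b := g l)))"
      unfolding maximal_minor_def
      by (intro sum.cong arg_cong2[of _ _ _ _ "(*)"] fdet_cong) auto
    finally show ?thesis .
  qed
  have g: "maximal_minor n M (g(j := f a)) = x j * maximal_minor n M g" if j: "j < n" for j
  proof -
    have "maximal_minor n M (g(j := g l)) = 0" if l: "l < n" "l \<noteq> j" for l
      unfolding maximal_minor_def by (rule fdet_equal_cols[of l n j]) (use l j in auto)
    then have "(\<Sum>l<n. x l * maximal_minor n M (g(j := g l))) =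
        (\<Sum>l<n. if l = j then x j * maximal_minor n M g else 0)"
      by (intro sum.cong) auto
    then show ?thesis using col[OF j, of g] j by simp
  qed
  have "maximal_minor n M f = (\<Sum>l<n. x l * maximal_minor n M (f(a := g l)))"
    using col[OF a, of f] by simp
  then have "maximal_minor n M f * maximal_minor n M g =
      (\<Sum>l<n. maximal_minor n M (f(a := g l)) * (x l * maximal_minor n M g))"
    by (simp add: sum_distrib_left sum_distrib_right mult_ac)
  also have "\<dots> = (\<Sum>j<n. maximal_minor n M (f(a := g j)) * maximal_minor n M (g(j := f a)))"
    by (rule sum.cong) (simp_all add: g)
  finally show ?thesis .
qed

lemma weight_update:
  assumes a: "a < n"
  shows "weight n (f(a := y)) + (if f a < n then 1 else 0) = weight n f + (if y < n then 1 else 0)"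
proof -
  have split: "weight n h = card {j \<in> {..<n} - {a}. h j < n} + (if h a < n then 1 else 0)" for h
  proof -
    have "{j \<in> {..<n}. h j < n} =
        {j \<in> {..<n} - {a}. h j < n} \<union> (if h a < n then {a} else {})" using a by auto
    then have "weight n h = card ({j \<in> {..<n} - {a}. h j < n} \<union> (if h a < n then {a} else {}))"
      unfolding weight_def by simp
    also have "\<dots> = card {j \<in> {..<n} - {a}. h j < n} + (if h a < n then 1 else 0)"
      by (subst card_Un_disjoint) auto
    finally show ?thesis .
  qed
  have "{j \<in> {..<n} - {a}. (f(a := y)) j < n} = {j \<in> {..<n} - {a}. f j < n}" by auto
  then show ?thesis using split[of "f(a := y)"] split[of f] by simp
qed

section \<open>Log-concavity of minors over a valuation ring\<close>

context valuation_subring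
begin

text \<open>
  Divisibility by \<open>y\<close> over \<open>V\<close>; in terms of the valuation \<open>v\<close> of \<open>V\<close> this is \<open>v x \<ge> v y\<close>, so that
  larger elements have smaller valuation.
\<close>

definition below :: "'k \<Rightarrow> 'k \<Rightarrow> bool" (infix \<open>\<preceq>\<close> 50) where
  "x \<preceq> y \<longleftrightarrow> (\<exists>v\<in>V. x = v * y)"

lemma one_mem: "1 \<in> V" using total[of 1] by simp
lemma zero_mem: "0 \<in> V" using total[of 0] by simp
lemma minus_one_mem: "- 1 \<in> V"
proof -
  have "inverse (- 1) = (- 1 :: 'k)" by simp
  then show ?thesis using total[of "- 1"] by metis
qed

lemma below_refl: "x \<preceq> x" unfolding below_def using one_mem by (metis mult_1)
lemma below_trans: "x \<preceq> y \<Longrightarrow> y \<preceq> z \<Longrightarrow> x \<preceq> z"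
  unfolding below_def using mult_closed by (metis mult.assoc)
lemma zero_below: "0 \<preceq> x" unfolding below_def using zero_mem by (metis mult_zero_left)
lemma uminus_below: "- x \<preceq> x" unfolding below_def using minus_one_mem by (metis mult_minus1)
lemma below_mult:
  assumes "x \<preceq> x'" "y \<preceq> y'"
  shows "x * y \<preceq> x' * y'"
proof -
  obtain v w where vw: "v \<in> V" "w \<in> V" "x = v * x'" "y = w * y'"
    using assms unfolding below_def by blast
  then have "x * y = (v * w) * (x' * y')" by simp
  then show ?thesis unfolding below_def using mult_closed vw by blast
qed

lemma below_cancel:
  assumes z: "z \<noteq> 0" and le: "x * z \<preceq> y * z"
  shows "x \<preceq> y"
proof -
  obtain v where v: "v \<in> V" "x * z = v * (y * z)" using le unfolding below_def by blast
  then have "x = v * y" using z by simp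
  then show ?thesis unfolding below_def using v(1) by blast
qed

lemma below_zero: "x \<preceq> 0 \<Longrightarrow> x = 0" unfolding below_def by auto

lemma below_total: "x \<preceq> y \<or> y \<preceq> x"
proof (cases "x = 0 \<or> y = 0")
  case True
  then show ?thesis using zero_below by auto
next
  case False
  then have "x = (x / y) * y" "y = inverse (x / y) * x" by simp_all
  then show ?thesis unfolding below_def using total[of "x / y"] by blast
qed

lemma below_add:
  assumes "x \<preceq> z" "y \<preceq> z"
  shows "x + y \<preceq> z"
proof -
  obtain v w where vw: "v \<in> V" "w \<in> V" "x = v * z" "y = w * z"
    using assms unfolding below_def by blast
  then have "x + y = (v + w) * z" by (simp add: distrib_right)
  then show ?thesis unfolding below_def using add_closed vw by blast
qed

lemma exists_largest:
  assumes "finite S" "S \<noteq> {}"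
  shows "\<exists>m\<in>S. \<forall>x\<in>S. h x \<preceq> h m"
  using assms
proof (induction S rule: finite_ne_induct)
  case (singleton x)
  then show ?case using below_refl by auto
next
  case (insert x S)
  then obtain m where m: "m \<in> S" "\<forall>y\<in>S. h y \<preceq> h m" by auto
  show ?case
  proof (cases "h x \<preceq> h m")
    case True
    then show ?thesis using m by auto
  next
    case False
    then have "h m \<preceq> h x" using below_total by blast
    then have "\<forall>y\<in>insert x S. h y \<preceq> h x" using m below_trans below_refl by blast
    then show ?thesis by blast
  qed
qed

text \<open>
  The ultrametric inequality: this is what extracts a single term from an exchange relation.
\<close>

lemma sum_below_some_term:
  assumes "finite S" "S \<noteq> {}"
  shows "\<exists>m\<in>S. sum h S \<preceq> h m"
proof -
  obtain m where m: "m \<in> S" "\<forall>x\<in>S. h x \<preceq> h m" using exists_largest[OF assms] by blast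
  have "sum h T \<preceq> h m" if "T \<subseteq> S" for T
    using finite_subset[OF that assms(1)] that
  proof (induction T)
    case empty
    then show ?case using zero_below by simp
  next
    case (insert x T)
    then show ?case using m below_add by auto
  qed
  then show ?thesis using m(1) by blast
qed

text \<open>
  Represent \<open>\<alpha>\<close> and \<open>\<beta>\<close> by maximal minors of \<open>(M | 1)\<close> for column selections \<open>f\<close> and \<open>g\<close> of weights
  \<open>m + 2\<close> and \<open>m\<close>, and replace each of them by a largest minor of the same weight. Among all such pairs,
  choose one for which \<open>f\<close> and \<open>g\<close> differ in as few columns as possible. Exchange a column of \<open>M\<close> that occurs in \<open>f\<close> and not in \<open>g\<close>
  for a column \<open>g j\<close>, where \<open>j\<close> indexes a dominating term of the exchange relation. If \<open>g j\<close> is a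
  unit column, both new selections have weight \<open>m + 1\<close>. If it is a column of \<open>M\<close>, the weights are
  unchanged and the new first selection is again a largest one, but it is closer to \<open>g\<close>, contrary
  to the choice.
\<close>

theorem minors_log_concave:
  fixes M :: "nat \<Rightarrow> nat \<Rightarrow> 'k"
  assumes \<alpha>: "\<alpha> \<in> minors (m + 2) n M" and \<beta>: "\<beta> \<in> minors m n M" and n: "m + 2 \<le> n"
  shows "\<exists>\<gamma>\<in>signed_minors (m + 1) n M. \<exists>\<delta>\<in>signed_minors (m + 1) n M. \<alpha> * \<beta> \<preceq> \<gamma> * \<delta>"
proof (cases "\<alpha> = 0 \<or> \<beta> = 0")
  case True
  have "0 \<in> signed_minors (m + 1) n M" unfolding signed_minors_def by simp
  moreover have "\<alpha> * \<beta> \<preceq> 0 * 0" using True below_refl by auto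
  ultimately show ?thesis by blast
next
  case False
  let ?F = "maximal_minor n M"
  define W where "W q = {f \<in> {..<n} \<rightarrow>\<^sub>E {..<2 * n}. weight n f = q}" for q
  have finW: "finite (W q)" for q unfolding W_def
    by (rule finite_subset[of _ "{..<n} \<rightarrow>\<^sub>E {..<2 * n}"]) (auto intro: finite_PiE)
  obtain f0 where f0: "f0 \<in> W (m + 2)" "?F f0 = \<alpha> \<or> ?F f0 = - \<alpha>"
    using minor_as_maximal_minor[OF \<alpha>] False n unfolding W_def by blast
  obtain g0 where g0: "g0 \<in> W m" "?F g0 = \<beta> \<or> ?F g0 = - \<beta>"
    using minor_as_maximal_minor[OF \<beta>] False n unfolding W_def by force
  obtain f1 where f1: "f1 \<in> W (m + 2)" "\<forall>f\<in>W (m + 2). ?F f \<preceq> ?F f1"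
    using exists_largest[OF finW, of "m + 2" ?F] f0(1) by blast
  obtain g1 where g1: "g1 \<in> W m" "\<forall>g\<in>W m. ?F g \<preceq> ?F g1"
    using exists_largest[OF finW, of m ?F] g0(1) by blast
  let ?best = "\<lambda>(f, g). f \<in> W (m + 2) \<and> g \<in> W m \<and> ?F f1 \<preceq> ?F f \<and> ?F g1 \<preceq> ?F g"
  let ?dist = "\<lambda>(f, g). card (f ` {..<n} - g ` {..<n})"
  have "?best (f1, g1)" using f1 g1 below_refl by simp
  then obtain f g where best: "?best (f, g)"
    and least: "\<And>f' g'. ?best (f', g') \<Longrightarrow> ?dist (f, g) \<le> ?dist (f', g')"
    using ex_has_least_nat[of ?best "(f1, g1)" ?dist] by (metis (lifting) surj_pair)
  have fW: "f \<in> W (m + 2)" and gW: "g \<in> W m" and f1f: "?F f1 \<preceq> ?F f" and g1g: "?F g1 \<preceq> ?F g"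
    using best by auto
  have \<alpha>f: "\<alpha> \<preceq> ?F f"
    using f0 f1 f1f below_trans below_refl uminus_below by (metis minus_minus)
  have \<beta>g: "\<beta> \<preceq> ?F g"
    using g0 g1 g1g below_trans below_refl uminus_below by (metis minus_minus)
  have nzf: "?F f \<noteq> 0" and nzg: "?F g \<noteq> 0" using \<alpha>f \<beta>g False below_zero by metis+
  have inj: "inj_on f {..<n}" "inj_on g {..<n}"
    using nzf nzg fdet_nonzero_inj_cols unfolding maximal_minor_def by blast+
  \<comment> \<open>\<open>f\<close> selects two more columns of \<open>M\<close> than \<open>g\<close>, and both are injective.\<close>
  have "\<exists>a<n. f a < n \<and> f a \<notin> g ` {..<n}"
  proof (rule ccontr)
    assume none: "\<not> ?thesis"
    have "f ` {j \<in> {..<n}. f j < n} \<subseteq> g ` {j \<in> {..<n}. g j < n}"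
    proof
      fix y assume "y \<in> f ` {j \<in> {..<n}. f j < n}"
      then obtain i where i: "i < n" "f i < n" "y = f i" by auto
      then obtain j where "j < n" "f i = g j" using none by auto
      then show "y \<in> g ` {j \<in> {..<n}. g j < n}" using i by auto
    qed
    then have "card (f ` {j \<in> {..<n}. f j < n}) \<le> card (g ` {j \<in> {..<n}. g j < n})"
      by (intro card_mono) auto
    moreover have "card (f ` {j \<in> {..<n}. f j < n}) = weight n f"
      unfolding weight_def by (rule card_image) (rule inj_on_subset[OF inj(1)], auto)
    moreover have "card (g ` {j \<in> {..<n}. g j < n}) = weight n g"
      unfolding weight_def by (rule card_image) (rule inj_on_subset[OF inj(2)], auto)
    ultimately show False using fW gW unfolding W_def by simp
  qed
  then obtain a where a: "a < n" "f a < n" "f a \<notin> g ` {..<n}" by blast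
  have "\<exists>j\<in>{..<n}. ?F f * ?F g \<preceq> ?F (f(a := g j)) * ?F (g(j := f a))"
    unfolding maximal_minor_exchange[OF a(1) nzg, of f]
    by (rule sum_below_some_term) (use a(1) in auto)
  then obtain j where j: "j < n" and le: "?F f * ?F g \<preceq> ?F (f(a := g j)) * ?F (g(j := f a))"
    by auto
  let ?f = "f(a := g j)" and ?g = "g(j := f a)"
  have fE: "f \<in> {..<n} \<rightarrow>\<^sub>E {..<2 * n}" and gE: "g \<in> {..<n} \<rightarrow>\<^sub>E {..<2 * n}"
    using fW gW unfolding W_def by auto
  have f'E: "?f \<in> {..<n} \<rightarrow>\<^sub>E {..<2 * n}"
    using fE PiE_mem[OF gE, of j] a(1) j by (auto simp: PiE_def extensional_def Pi_def)
  have g'E: "?g \<in> {..<n} \<rightarrow>\<^sub>E {..<2 * n}"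
    using gE PiE_mem[OF fE, of a] a(1) j by (auto simp: PiE_def extensional_def Pi_def)
  have wf: "weight n ?f + 1 = (m + 2) + (if g j < n then 1 else 0)"
    using weight_update[OF a(1), of f "g j"] a(2) fW unfolding W_def by simp
  have wg: "weight n ?g + (if g j < n then 1 else 0) = m + 1"
    using weight_update[OF j, of g "f a"] a(2) gW unfolding W_def by simp
  have "\<not> g j < n"
  proof
    assume gj: "g j < n"
    have f'W: "?f \<in> W (m + 2)" and g'W: "?g \<in> W m"
      using wf wg gj f'E g'E unfolding W_def by auto
    have "?F ?g \<preceq> ?F g" using g1(2) g'W g1g below_trans by blast
    then have "?F f * ?F g \<preceq> ?F ?f * ?F g"
      using le below_mult[OF below_refl] below_trans by blast
    then have ff: "?F f \<preceq> ?F ?f" by (rule below_cancel[OF nzg])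
    have "?F f1 \<preceq> ?F ?f" using f1f ff by (rule below_trans)
    then have "?best (?f, g)" using f'W gW g1g by simp
    then have ge: "?dist (f, g) \<le> ?dist (?f, g)" by (rule least)
    have "?f i \<in> f ` {..<n} \<or> ?f i \<in> g ` {..<n}" if "i < n" for i
      using that j by (cases "i = a") auto
    then have sub: "?f ` {..<n} - g ` {..<n} \<subseteq> f ` {..<n} - g ` {..<n}" by blast
    have "f a \<noteq> ?f i" if "i < n" for i
    proof (cases "i = a")
      case True
      then show ?thesis using a(3) j by auto
    next
      case False
      then show ?thesis using inj_onD[OF inj(1), of a i] a(1) that by auto
    qed
    then have "f a \<notin> ?f ` {..<n}" by blast
    moreover have "f a \<in> f ` {..<n} - g ` {..<n}" using a by blast
    ultimately have "?f ` {..<n} - g ` {..<n} \<subset> f ` {..<n} - g ` {..<n}" using sub by blast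
    then have "?dist (?f, g) < ?dist (f, g)" by (simp add: psubset_card_mono)
    then show False using ge by simp
  qed
  then have "weight n ?f = m + 1" "weight n ?g = m + 1" using wf wg by auto
  then have "?F ?f \<in> signed_minors (m + 1) n M" "?F ?g \<in> signed_minors (m + 1) n M"
    using maximal_minor_as_minor[of ?f n M] maximal_minor_as_minor[of ?g n M] f'E g'E
    by (auto simp: PiE_def)
  moreover have "\<alpha> * \<beta> \<preceq> ?F ?f * ?F ?g" using below_mult[OF \<alpha>f \<beta>g] le below_trans by blast
  ultimately show ?thesis by blast
qed

end

section \<open>Fractional ideals spanned by minors\<close>

abbreviation minor_module :: "nat \<Rightarrow> nat \<Rightarrow> (nat \<Rightarrow> nat \<Rightarrow> 'a fract) \<Rightarrow> 'a::idom fract set" where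
  "minor_module k n M \<equiv> fract_module.span (minors k n M)"

lemma signed_minors_in_span: "signed_minors k n M \<subseteq> minor_module k n M"
proof
  fix x assume "x \<in> signed_minors k n M"
  then consider "x = 0" | "x \<in> minors k n M" | "- x \<in> minors k n M"
    unfolding signed_minors_def by blast
  then show "x \<in> minor_module k n M"
  proof cases
    case 3
    then have "- (- x) \<in> minor_module k n M"
      by (intro fract_module.span_neg fract_module.span_base)
    then show ?thesis by simp
  qed (auto intro: fract_module.span_zero fract_module.span_base)
qed

lemma bij_betw_pick:
  assumes "S \<subseteq> {..<n}" "card S = k"
  shows "bij_betw (pick S) {..<k} S"
proof (rule bij_betw_imageI)
  show inj: "inj_on (pick S) {..<k}"
  proof (rule inj_onI, rule ccontr)
    fix x y assume xy: "x \<in> {..<k}" "y \<in> {..<k}" "pick S x = pick S y" "x \<noteq> y"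
    then show False
      using pick_mono_le[of y S x] pick_mono_le[of x S y] assms(2) by (cases x y rule: linorder_cases) auto
  qed
  have "pick S ` {..<k} \<subseteq> S" using pick_in_set_le[of _ S] assms(2) by auto
  moreover have "finite S" using assms(1) finite_subset by blast
  ultimately show "pick S ` {..<k} = S"
    using card_image[OF inj] assms(2) by (intro card_subset_eq) auto
qed

lemma to_fract_det:
  "to_fract (det (mat k k (\<lambda>(i, j). F i j))) = fdet k (\<lambda>i j. to_fract (F i j))"
proof -
  have "map_mat to_fract (mat k k (\<lambda>(i, j). F i j)) = mat k k (\<lambda>(i, j). to_fract (F i j))"
    by (rule eq_matI) auto
  then show ?thesis unfolding fdet_def by (simp flip: comm_ring_hom.hom_det[OF to_fract_hom])
qed

lemma minor_module_product:
  fixes P Q :: "nat \<Rightarrow> nat \<Rightarrow> 'a::idom fract"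
  assumes R: "\<And>i j. i < n \<Longrightarrow> j < n \<Longrightarrow> R i j = (\<Sum>l<n. P i l * Q l j)"
  shows "minor_module k n R \<subseteq> minor_module k n P \<cdot>\<^sub>F minor_module k n Q"
proof (rule fract_module.span_minimal[OF _ subspace_frac_mult], rule subsetI)
  fix x assume "x \<in> minors k n R"
  then obtain r c where r: "r \<in> {..<k} \<rightarrow> {..<n}" and c: "c \<in> {..<k} \<rightarrow> {..<n}"
    and x: "x = fdet k (\<lambda>i j. R (r i) (c j))" unfolding minors_def by blast
  have "x = fdet k (\<lambda>i j. \<Sum>l<n. P (r i) l * Q l (c j))"
    unfolding x by (rule fdet_cong) (use r c R in \<open>auto simp: Pi_iff\<close>)
  also have "\<dots> = (\<Sum>S | S \<subseteq> {..<n} \<and> card S = k.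
      fdet k (\<lambda>i j. P (r i) (pick S j)) * fdet k (\<lambda>i j. Q (pick S i) (c j)))"
    by (rule cauchy_binet[of n k pick "\<lambda>i l. P (r i) l" "\<lambda>l j. Q l (c j)"]) (rule bij_betw_pick)
  also have "\<dots> \<in> minor_module k n P \<cdot>\<^sub>F minor_module k n Q"
  proof (rule fract_module.subspace_sum[OF subspace_frac_mult])
    fix S assume "S \<in> {S. S \<subseteq> {..<n} \<and> card S = k}"
    then have S: "S \<subseteq> {..<n}" "card S = k" by auto
    have "pick S \<in> {..<k} \<rightarrow> {..<n}"
      using bij_betw_pick[OF S] S(1) unfolding bij_betw_def by auto
    then show "fdet k (\<lambda>i j. P (r i) (pick S j)) * fdet k (\<lambda>i j. Q (pick S i) (c j))
      \<in> minor_module k n P \<cdot>\<^sub>F minor_module k n Q"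
      by (intro frac_multI fract_module.span_base minorsI r c)
  qed
  finally show "x \<in> minor_module k n P \<cdot>\<^sub>F minor_module k n Q" .
qed

lemma sum_product_assoc:
  fixes P Q H :: "nat \<Rightarrow> nat \<Rightarrow> 'b::comm_ring_1"
  shows "(\<Sum>l<n. P i l * (\<Sum>t<n. Q l t * H t j)) = (\<Sum>t<n. (\<Sum>l<n. P i l * Q l t) * H t j)"
proof -
  have "(\<Sum>l<n. P i l * (\<Sum>t<n. Q l t * H t j)) = (\<Sum>l<n. \<Sum>t<n. P i l * Q l t * H t j)"
    by (simp add: sum_distrib_left mult.assoc)
  also have "\<dots> = (\<Sum>t<n. \<Sum>l<n. P i l * Q l t * H t j)" by (rule sum.swap)
  finally show ?thesis by (simp add: sum_distrib_right)
qed

text \<open>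
  Apply Cauchy-Binet to \<open>Q = P\<inverse> R\<close>. The minors of \<open>P\<inverse>\<close> become minors of \<open>P\<close> of complementary size
  after multiplication by \<open>det P\<close>.
\<close>

lemma det_times_minor_right_factor:
  fixes P Q :: "nat \<Rightarrow> nat \<Rightarrow> 'a::idom fract"
  assumes R: "\<And>i j. i < n \<Longrightarrow> j < n \<Longrightarrow> R i j = (\<Sum>l<n. P i l * Q l j)"
    and nz: "fdet n P \<noteq> 0" and k: "k \<le> n"
  shows "minor_module k n Q \<subseteq>
    {w. w * fdet n P \<in> minor_module (n - k) n P \<cdot>\<^sub>F minor_module k n R}" (is "_ \<subseteq> ?T")
proof -
  obtain H where PH: "\<And>i j. i < n \<Longrightarrow> j < n \<Longrightarrow> (\<Sum>l<n. P i l * H l j) = (if i = j then 1 else 0)"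
    and HP: "\<And>i j. i < n \<Longrightarrow> j < n \<Longrightarrow> (\<Sum>l<n. H i l * P l j) = (if i = j then 1 else 0)"
    by (rule fdet_inverse[OF nz]) (rule that)
  have "Q i j = (\<Sum>l<n. H i l * R l j)" if ij: "i < n" "j < n" for i j
  proof -
    have "(\<Sum>l<n. H i l * R l j) = (\<Sum>l<n. H i l * (\<Sum>t<n. P l t * Q t j))"
      by (rule sum.cong) (use R ij in auto)
    also have "\<dots> = (\<Sum>t<n. (if i = t then 1 else 0) * Q t j)"
      unfolding sum_product_assoc by (rule sum.cong) (use HP ij in auto)
    finally show ?thesis using ij by (simp add: if_distrib[of "\<lambda>y. y * _"] cong: if_cong)
  qed
  then have "minor_module k n Q \<subseteq> minor_module k n H \<cdot>\<^sub>F minor_module k n R"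
    by (rule minor_module_product)
  also have "\<dots> \<subseteq> ?T"
  proof (rule span_mult_span_le[OF subspace_quotient[OF subspace_frac_mult]])
    fix x y assume x: "x \<in> minors k n H" and y: "y \<in> minors k n R"
    have "fdet n P * x \<in> minor_module (n - k) n P"
      using minor_of_inverse[OF PH x k] signed_minors_in_span by blast
    then have "fdet n P * x * y \<in> minor_module (n - k) n P \<cdot>\<^sub>F minor_module k n R"
      by (rule frac_multI) (rule fract_module.span_base[OF y])
    then show "x * y \<in> ?T" by (simp add: mult_ac)
  qed
  finally show ?thesis .
qed

lemma det_times_minor_left_factor:
  fixes P Q :: "nat \<Rightarrow> nat \<Rightarrow> 'a::idom fract"
  assumes R: "\<And>i j. i < n \<Longrightarrow> j < n \<Longrightarrow> R i j = (\<Sum>l<n. P i l * Q l j)"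
    and nz: "fdet n Q \<noteq> 0" and k: "k \<le> n"
  shows "minor_module k n P \<subseteq>
    {w. w * fdet n Q \<in> minor_module (n - k) n Q \<cdot>\<^sub>F minor_module k n R}" (is "_ \<subseteq> ?T")
proof -
  obtain H where QH: "\<And>i j. i < n \<Longrightarrow> j < n \<Longrightarrow> (\<Sum>l<n. Q i l * H l j) = (if i = j then 1 else 0)"
    using fdet_inverse[OF nz] by metis
  have "P i j = (\<Sum>l<n. R i l * H l j)" if ij: "i < n" "j < n" for i j
  proof -
    have "(\<Sum>l<n. R i l * H l j) = (\<Sum>l<n. (\<Sum>t<n. P i t * Q t l) * H l j)"
      by (rule sum.cong) (use R ij in auto)
    also have "\<dots> = (\<Sum>t<n. P i t * (if t = j then 1 else 0))"
      unfolding sum_product_assoc[symmetric] by (rule sum.cong) (use QH ij in auto)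
    finally show ?thesis using ij by (simp add: if_distrib[of "\<lambda>y. _ * y"] cong: if_cong)
  qed
  then have "minor_module k n P \<subseteq> minor_module k n R \<cdot>\<^sub>F minor_module k n H"
    by (rule minor_module_product)
  also have "\<dots> \<subseteq> ?T"
  proof (rule span_mult_span_le[OF subspace_quotient[OF subspace_frac_mult]])
    fix x y assume x: "x \<in> minors k n R" and y: "y \<in> minors k n H"
    have "fdet n Q * y \<in> minor_module (n - k) n Q"
      using minor_of_inverse[OF QH y k] signed_minors_in_span by blast
    then have "fdet n Q * y * x \<in> minor_module (n - k) n Q \<cdot>\<^sub>F minor_module k n R"
      by (rule frac_multI) (rule fract_module.span_base[OF x])
    then show "x * y \<in> ?T" by (simp add: mult_ac)
  qed
  finally show ?thesis .
qed

lemma minor_module_top: "minor_module n n M = fract_module.span {fdet n M}"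
proof
  have "fdet n M \<in> minors n n M" using minorsI[of "\<lambda>i. i" n n "\<lambda>i. i" M] by auto
  then show "fract_module.span {fdet n M} \<subseteq> minor_module n n M"
    by (intro fract_module.span_mono) simp
  show "minor_module n n M \<subseteq> fract_module.span {fdet n M}"
  proof (rule fract_module.span_minimal[OF _ fract_module.subspace_span], rule subsetI)
    fix x assume "x \<in> minors n n M"
    then obtain r c where r: "r \<in> {..<n} \<rightarrow> {..<n}" and c: "c \<in> {..<n} \<rightarrow> {..<n}"
      and x: "x = fdet n (\<lambda>i j. M (r i) (c j))" unfolding minors_def by blast
    show "x \<in> fract_module.span {fdet n M}"
    proof (cases "x = 0")
      case True
      then show ?thesis by (simp add: fract_module.span_zero)
    next
      case False
      have ir: "inj_on r {..<n}"
        using fdet_nonzero_inj_rows[of n "\<lambda>i j. M i (c j)" r] False x by simp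
      have ic: "inj_on c {..<n}"
        using fdet_nonzero_inj_cols[of n "\<lambda>i j. M (r i) j" c] False x by simp
      obtain p where p: "p permutes {..<n}" "\<And>i. i \<in> {..<n} \<Longrightarrow> p i = r i"
        by (rule extend_to_permutation[OF ir, of n]) (use r in auto)
      obtain q where q: "q permutes {..<n}" "\<And>i. i \<in> {..<n} \<Longrightarrow> q i = c i"
        by (rule extend_to_permutation[OF ic, of n]) (use c in auto)
      have "x = fdet n (\<lambda>i j. M (p i) (q j))" unfolding x by (rule fdet_cong) (simp add: p q)
      also have "\<dots> = of_int (sign p) * fdet n (\<lambda>i j. M i (q j))"
        using fdet_permute_rows[OF p(1), of "\<lambda>i j. M i (q j)"] .
      also have "fdet n (\<lambda>i j. M i (q j)) = of_int (sign q) * fdet n M"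
        using fdet_permute_cols[OF q(1), of M] .
      finally have x': "x = of_int (sign p) * (of_int (sign q) * fdet n M)" .
      have "fdet n M \<in> fract_module.span {fdet n M}" by (rule fract_module.span_base) simp
      then show ?thesis unfolding x'
        by (cases p rule: sign_cases; cases q rule: sign_cases) (auto intro: fract_module.span_neg)
    qed
  qed
qed

text \<open>
  The multiples of \<open>\<alpha> \<beta>\<close> in the right-hand side are tested at each maximal ideal \<open>P\<close>, where
  log-concavity over the valuation ring \<open>\<oo>\<^sub>P\<close> provides a denominator outside \<open>P\<close>.
\<close>

lemma minor_module_log_concave:
  fixes M :: "nat \<Rightarrow> nat \<Rightarrow> 'a::idom fract"
  assumes dd: "dedekind_domain TYPE('a)" and n: "m + 2 \<le> n"
  shows "minor_module (m + 2) n M \<cdot>\<^sub>F minor_module m n M \<subseteq>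
    minor_module (m + 1) n M \<cdot>\<^sub>F minor_module (m + 1) n M" (is "_ \<subseteq> ?L")
proof (rule span_mult_span_le[OF subspace_frac_mult])
  have noeth: "noetherian_ring (class_ring :: 'a ring)"
    using dd unfolding dedekind_domain_def by auto
  fix \<alpha> \<beta> assume \<alpha>: "\<alpha> \<in> minors (m + 2) n M" and \<beta>: "\<beta> \<in> minors m n M"
  show "\<alpha> * \<beta> \<in> ?L"
  proof (rule mem_subspace_locally[OF noeth subspace_frac_mult])
    fix P :: "'a set" assume P: "maximalideal P class_ring"
    note V = valuation_local_ring_at[OF dd P]
    obtain \<gamma> \<delta> where g: "\<gamma> \<in> signed_minors (m + 1) n M" "\<delta> \<in> signed_minors (m + 1) n M"
      and le: "valuation_subring.below (local_ring_at P) (\<alpha> * \<beta>) (\<gamma> * \<delta>)"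
      using valuation_subring.minors_log_concave[OF V \<alpha> \<beta> n] by blast
    obtain v where v: "v \<in> local_ring_at P" "\<alpha> * \<beta> = v * (\<gamma> * \<delta>)"
      using le unfolding valuation_subring.below_def[OF V] by blast
    obtain r s where s: "s \<notin> P" and "v = to_fract r / to_fract s"
      using v(1) unfolding local_ring_at_def by blast
    then have eq: "\<alpha> * \<beta> = to_fract r / to_fract s * (\<gamma> * \<delta>)" using v(2) by simp
    have "s \<noteq> 0" using s ideal_class_ringD[OF maximalideal_class_ringD(1)[OF P]] by auto
    then have "to_fract s * (\<alpha> * \<beta>) = to_fract r * (\<gamma> * \<delta>)" unfolding eq by simp
    moreover have "\<gamma> * \<delta> \<in> ?L" using g signed_minors_in_span by (intro frac_multI) blast+
    ultimately have "to_fract s * (\<alpha> * \<beta>) \<in> ?L"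
      using fract_module.subspace_scale[OF subspace_frac_mult] by metis
    then show "\<exists>s. s \<notin> P \<and> to_fract s * (\<alpha> * \<beta>) \<in> ?L" using s by blast
  qed
qed

lemma one_in_minor_module_0: "1 \<in> minor_module 0 n M"
proof -
  have "fdet 0 (\<lambda>i j. M i j) = 1" unfolding fdet_def by simp
  moreover have "fdet 0 (\<lambda>i j. M i j) \<in> minors 0 n M" using minorsI[of "\<lambda>i. i" 0 n "\<lambda>i. i" M] by simp
  ultimately show ?thesis by (metis fract_module.span_base)
qed

text \<open>
  This is how \<open>\<bb>\<^sub>k \<aa>\<^sub>n \<subseteq> \<aa>\<^sub>n\<^sub>-\<^sub>k \<cc>\<^sub>k\<close> yields \<open>\<aa>\<^sub>k \<bb>\<^sub>k (\<aa>\<^sub>n \<aa>\<^sub>k\<inverse> \<aa>\<^sub>n\<^sub>-\<^sub>k\<inverse>) \<subseteq> \<cc>\<^sub>k\<close>. The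
  reason is that \<open>I I\<inverse> \<subseteq> \<oo>\<close>, applied to \<open>I = \<aa>\<^sub>k\<close> and \<open>I = \<aa>\<^sub>n\<^sub>-\<^sub>k\<close>.
\<close>

lemma scaled_product_in_subspace:
  fixes L :: "'a::idom fract set"
  assumes L: "fract_module.subspace L"
    and h: "\<And>b p. b \<in> B \<Longrightarrow> p \<in> D \<Longrightarrow> b * p \<in> E \<cdot>\<^sub>F L"
    and a: "a \<in> A" and b: "b \<in> B" and u: "u \<in> D \<cdot>\<^sub>F frac_inv A \<cdot>\<^sub>F frac_inv E"
  shows "a * b * u \<in> L"
proof -
  have scale: "x * l \<in> L" if "x \<in> range to_fract" "l \<in> L" for x l
    using that fract_module.subspace_scale[OF L] by auto
  have "D \<cdot>\<^sub>F frac_inv A \<cdot>\<^sub>F frac_inv E \<subseteq> {w. w * (a * b) \<in> L}"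
  proof (rule frac_mult3_leI[OF subspace_quotient[OF L]])
    fix p q r assume p: "p \<in> D" and q: "q \<in> frac_inv A" and r: "r \<in> frac_inv E"
    have "E \<cdot>\<^sub>F L \<subseteq> {w. w * r \<in> L}"
    proof (rule frac_mult_leI[OF subspace_quotient[OF L]])
      fix e l assume "e \<in> E" "l \<in> L"
      then have "r * e * l \<in> L" using r by (intro scale) (auto simp: frac_inv_def)
      then show "e * l \<in> {w. w * r \<in> L}" by (simp add: mult_ac)
    qed
    then have "b * p * r \<in> L" using h[OF b p] by auto
    moreover have "q * a \<in> range to_fract" using q a unfolding frac_inv_def by auto
    ultimately have "q * a * (b * p * r) \<in> L" using scale by blast
    then show "p * q * r \<in> {w. w * (a * b) \<in> L}" by (simp add: mult_ac)
  qed
  then show ?thesis using u by (auto simp: mult_ac)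
qed

section \<open>Determinantal divisors of a product\<close>

definition fract_entries :: "'a::idom mat \<Rightarrow> nat \<Rightarrow> nat \<Rightarrow> 'a fract" where
  "fract_entries A i j = to_fract (A $$ (i, j))"

text \<open>
  Enumerating the chosen rows and columns increasingly costs two permutations, which only affect
  the sign of a minor.
\<close>

lemma frac_of_det_divisor:
  fixes A :: "'a::idom mat"
  assumes A: "A \<in> carrier_mat n n"
  shows "frac_of (det_divisor k A) = minor_module k n (fract_entries A)"
proof -
  let ?M = "fract_entries A"
  let ?S = "{det (submatrix A I J) | I J.
    I \<subseteq> {..<dim_row A} \<and> J \<subseteq> {..<dim_col A} \<and> card I = k \<and> card J = k}"
  have sub: "to_fract (det (submatrix A I J)) = fdet k (\<lambda>i j. ?M (pick I i) (pick J j))"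
    if "I \<subseteq> {..<n}" "J \<subseteq> {..<n}" "card I = k" "card J = k" for I J
  proof -
    have "{i. i < n \<and> i \<in> I} = I" "{i. i < n \<and> i \<in> J} = J" using that by auto
    then have "submatrix A I J = mat k k (\<lambda>(i, j). A $$ (pick I i, pick J j))"
      unfolding submatrix_def using A that by simp
    then show ?thesis using to_fract_det[of k "\<lambda>i j. A $$ (pick I i, pick J j)"]
      by (simp add: fract_entries_def)
  qed
  have "to_fract ` ?S \<subseteq> minors k n ?M"
  proof
    fix x assume "x \<in> to_fract ` ?S"
    then obtain I J where IJ: "I \<subseteq> {..<n}" "J \<subseteq> {..<n}" "card I = k" "card J = k"
      and x: "x = to_fract (det (submatrix A I J))" using A by auto
    have "pick I \<in> {..<k} \<rightarrow> {..<n}" "pick J \<in> {..<k} \<rightarrow> {..<n}"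
      using bij_betw_pick[OF IJ(1,3)] bij_betw_pick[OF IJ(2,4)] IJ(1,2)
      unfolding bij_betw_def by auto
    then show "x \<in> minors k n ?M" unfolding x sub[OF IJ] by (rule minorsI)
  qed
  then have 1: "fract_module.span (to_fract ` ?S) \<subseteq> minor_module k n ?M"
    by (rule fract_module.span_mono)
  have "minors k n ?M \<subseteq> fract_module.span (to_fract ` ?S)"
  proof
    fix x assume "x \<in> minors k n ?M"
    then obtain r c where r: "r \<in> {..<k} \<rightarrow> {..<n}" and c: "c \<in> {..<k} \<rightarrow> {..<n}"
      and x: "x = fdet k (\<lambda>i j. ?M (r i) (c j))" unfolding minors_def by blast
    show "x \<in> fract_module.span (to_fract ` ?S)"
    proof (cases "x = 0")
      case True
      then show ?thesis by (simp add: fract_module.span_zero)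
    next
      case False
      have ir: "inj_on r {..<k}"
        using fdet_nonzero_inj_rows[of k "\<lambda>i j. ?M i (c j)" r] False x by simp
      have ic: "inj_on c {..<k}"
        using fdet_nonzero_inj_cols[of k "\<lambda>i j. ?M (r i) j" c] False x by simp
      let ?I = "r ` {..<k}" and ?J = "c ` {..<k}"
      have IJ: "?I \<subseteq> {..<n}" "?J \<subseteq> {..<n}" "card ?I = k" "card ?J = k"
        using r c card_image[OF ir] card_image[OF ic] by auto
      obtain p where p: "p permutes {..<k}" "\<And>i. i < k \<Longrightarrow> r i = pick ?I (p i)"
        using permutation_between_enumerations[OF inj_on_imp_bij_betw[OF ir] bij_betw_pick[OF IJ(1,3)]]
        by metis
      obtain q where q: "q permutes {..<k}" "\<And>i. i < k \<Longrightarrow> c i = pick ?J (q i)"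
        using permutation_between_enumerations[OF inj_on_imp_bij_betw[OF ic] bij_betw_pick[OF IJ(2,4)]]
        by metis
      have "x = fdet k (\<lambda>i j. ?M (pick ?I (p i)) (pick ?J (q j)))"
        unfolding x by (rule fdet_cong) (simp add: p(2)[symmetric] q(2)[symmetric])
      also have "\<dots> = of_int (sign p) * fdet k (\<lambda>i j. ?M (pick ?I i) (pick ?J (q j)))"
        using fdet_permute_rows[OF p(1), of "\<lambda>i j. ?M (pick ?I i) (pick ?J (q j))"] .
      also have "fdet k (\<lambda>i j. ?M (pick ?I i) (pick ?J (q j))) =
          of_int (sign q) * fdet k (\<lambda>i j. ?M (pick ?I i) (pick ?J j))"
        using fdet_permute_cols[OF q(1), of "\<lambda>i j. ?M (pick ?I i) (pick ?J j)"] .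
      finally have x': "x = of_int (sign p) * (of_int (sign q) * to_fract (det (submatrix A ?I ?J)))"
        unfolding sub[OF IJ] .
      have "det (submatrix A ?I ?J) \<in> ?S" using IJ A by auto
      then have "to_fract (det (submatrix A ?I ?J)) \<in> fract_module.span (to_fract ` ?S)"
        by (intro fract_module.span_base imageI)
      then show ?thesis unfolding x'
        by (cases p rule: sign_cases; cases q rule: sign_cases) (auto intro: fract_module.span_neg)
    qed
  qed
  then have "minor_module k n ?M \<subseteq> fract_module.span (to_fract ` ?S)"
    by (rule fract_module.span_minimal) simp
  then show ?thesis using 1 unfolding det_divisor_def frac_of_genideal by blast
qed

lemma subspace_det_divisor: "fract_module.subspace (frac_of (det_divisor k A))"
  unfolding det_divisor_def frac_of_genideal by simp

lemma fract_entries_mult: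
  assumes "A \<in> carrier_mat n n" "B \<in> carrier_mat n n" "i < n" "j < n"
  shows "fract_entries (A * B) i j = (\<Sum>l<n. fract_entries A i l * fract_entries B l j)"
  using assms unfolding fract_entries_def by (simp add: scalar_prod_def atLeast0LessThan)

lemma fdet_fract_entries:
  assumes "A \<in> carrier_mat n n"
  shows "fdet n (fract_entries A) = to_fract (det A)"
proof -
  have "mat n n (\<lambda>(i, j). A $$ (i, j)) = A" by (rule eq_matI) (use assms in auto)
  then show ?thesis
    using to_fract_det[of n "\<lambda>i j. A $$ (i, j)"] unfolding fract_entries_def by simp
qed

lemma frac_of_det_divisor_top:
  assumes "A \<in> carrier_mat n n"
  shows "frac_of (det_divisor n A) = fract_module.span {to_fract (det A)}"
  unfolding frac_of_det_divisor[OF assms] minor_module_top fdet_fract_entries[OF assms] ..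

lemma det_divisor_top_principal:
  fixes A :: "'a::idom mat"
  assumes A: "A \<in> carrier_mat n n"
  shows "principalideal (det_divisor n A) class_ring"
proof -
  have "frac_of (det_divisor n A) = frac_of (Idl\<^bsub>class_ring\<^esub> {det A})"
    unfolding frac_of_det_divisor_top[OF A] frac_of_genideal by simp
  then have eq: "det_divisor n A = Idl\<^bsub>class_ring\<^esub> {det A}"
    unfolding frac_of_def by (simp add: inj_image_eq_iff inj_def)
  show ?thesis
  proof (rule principalidealI)
    show "ideal (det_divisor n A) class_ring"
      unfolding eq by (rule ring.genideal_ideal[OF class_ring.ring_axioms]) auto
  qed (use eq in auto)
qed

lemma det_divisor_log_concave:
  fixes A :: "'a::idom mat"
  assumes "dedekind_domain TYPE('a)" and A: "A \<in> carrier_mat n n" and "m + 2 \<le> n"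
  shows "frac_of (det_divisor (m + 2) A) \<cdot>\<^sub>F frac_of (det_divisor m A) \<subseteq>
    frac_of (det_divisor (m + 1) A) \<cdot>\<^sub>F frac_of (det_divisor (m + 1) A)"
  unfolding frac_of_det_divisor[OF A]
  by (rule minor_module_log_concave[OF assms(1,3)])

lemma det_divisor_1_square_dvd:
  fixes A :: "'a::idom mat"
  assumes dd: "dedekind_domain TYPE('a)" and A: "A \<in> carrier_mat n n" and n: "2 \<le> n"
  shows "frac_of (det_divisor 1 A) \<cdot>\<^sub>F frac_of (det_divisor 1 A) dvd\<^sub>F frac_of (det_divisor 2 A)"
  unfolding frac_dvd_def
proof
  fix x assume x: "x \<in> frac_of (det_divisor 2 A)"
  have "1 \<in> frac_of (det_divisor 0 A)"
    unfolding frac_of_det_divisor[OF A] by (rule one_in_minor_module_0)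
  with x have "x * 1 \<in> frac_of (det_divisor 2 A) \<cdot>\<^sub>F frac_of (det_divisor 0 A)"
    by (rule frac_multI)
  then show "x \<in> frac_of (det_divisor 1 A) \<cdot>\<^sub>F frac_of (det_divisor 1 A)"
    using det_divisor_log_concave[OF dd A, of 0] n by (auto simp: numeral_2_eq_2)
qed

lemma det_divisor_square_quotient_dvd:
  fixes A :: "'a::idom mat"
  assumes dd: "dedekind_domain TYPE('a)" and A: "A \<in> carrier_mat n n" and k: "2 \<le> k" "k \<le> n"
    and nz: "det_divisor (k - 2) A \<noteq> {0}"
  shows "frac_of (det_divisor (k - 1) A) \<cdot>\<^sub>F frac_of (det_divisor (k - 1) A) \<cdot>\<^sub>F
    frac_inv (frac_of (det_divisor (k - 2) A)) dvd\<^sub>F frac_of (det_divisor k A)"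
  unfolding frac_dvd_def
proof (rule le_mult_inverse[OF subspace_frac_mult])
  have "k - 2 + 2 = k" "k - 2 + 1 = k - 1" "k - 2 + 2 \<le> n" using k by auto
  then show "frac_of (det_divisor k A) \<cdot>\<^sub>F frac_of (det_divisor (k - 2) A) \<subseteq>
      frac_of (det_divisor (k - 1) A) \<cdot>\<^sub>F frac_of (det_divisor (k - 1) A)"
    using det_divisor_log_concave[OF dd A, of "k - 2"] by simp
  have "ideal (det_divisor (k - 2) A) class_ring"
    unfolding det_divisor_def by (rule ring.genideal_ideal[OF class_ring.ring_axioms]) auto
  then show "1 \<in> frac_of (det_divisor (k - 2) A) \<cdot>\<^sub>F frac_inv (frac_of (det_divisor (k - 2) A))"
    by (rule one_in_frac_mult_inv[OF dd _ nz])
qed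

lemma det_divisor_mult_dvd:
  assumes A: "A \<in> carrier_mat n n" and B: "B \<in> carrier_mat n n"
  shows "frac_of (det_divisor k A) \<cdot>\<^sub>F frac_of (det_divisor k B) dvd\<^sub>F frac_of (det_divisor k (A * B))"
  unfolding frac_dvd_def frac_of_det_divisor[OF A]
    frac_of_det_divisor[OF B] frac_of_det_divisor[OF mult_carrier_mat[OF A B]]
  by (rule minor_module_product) (rule fract_entries_mult[OF A B])

lemma det_divisor_top_mult:
  assumes A: "A \<in> carrier_mat n n" and B: "B \<in> carrier_mat n n"
  shows "frac_of (det_divisor n A) \<cdot>\<^sub>F frac_of (det_divisor n B) = frac_of (det_divisor n (A * B))"
proof
  show "frac_of (det_divisor n (A * B)) \<subseteq> frac_of (det_divisor n A) \<cdot>\<^sub>F frac_of (det_divisor n B)"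
    using det_divisor_mult_dvd[OF A B, of n] unfolding frac_dvd_def .
  show "frac_of (det_divisor n A) \<cdot>\<^sub>F frac_of (det_divisor n B) \<subseteq> frac_of (det_divisor n (A * B))"
    unfolding frac_of_det_divisor_top[OF A] frac_of_det_divisor_top[OF B]
      frac_of_det_divisor_top[OF mult_carrier_mat[OF A B]]
    by (rule span_mult_span_le)
       (auto simp: det_mult[OF A B] intro!: fract_module.span_base)
qed

lemma mult_det_divisor_top:
  assumes A: "A \<in> carrier_mat n n" and L: "fract_module.subspace L"
    and y: "y * fdet n (fract_entries A) \<in> L" and p: "p \<in> frac_of (det_divisor n A)"
  shows "y * p \<in> L"
proof -
  have "frac_of (det_divisor n A) \<subseteq> {w. w * y \<in> L}"
    unfolding frac_of_det_divisor_top[OF A]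
    by (rule fract_module.span_minimal[OF _ subspace_quotient[OF L]])
       (use y fdet_fract_entries[OF A] in \<open>auto simp: mult.commute\<close>)
  then show ?thesis using p by (auto simp: mult.commute)
qed

lemma det_divisor_top_times_right_factor:
  assumes A: "A \<in> carrier_mat n n" "det A \<noteq> 0" and B: "B \<in> carrier_mat n n" and k: "k \<le> n"
    and y: "y \<in> frac_of (det_divisor k B)" and p: "p \<in> frac_of (det_divisor n A)"
  shows "y * p \<in> frac_of (det_divisor (n - k) A) \<cdot>\<^sub>F frac_of (det_divisor k (A * B))"
proof (rule mult_det_divisor_top[OF A(1) subspace_frac_mult _ p])
  have nz: "fdet n (fract_entries A) \<noteq> 0" using fdet_fract_entries[OF A(1)] A(2) by simp
  have "minor_module k n (fract_entries B) \<subseteq> {w. w * fdet n (fract_entries A) \<in>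
      minor_module (n - k) n (fract_entries A) \<cdot>\<^sub>F minor_module k n (fract_entries (A * B))}"
    by (rule det_times_minor_right_factor[OF _ nz k]) (rule fract_entries_mult[OF A(1) B])
  then show "y * fdet n (fract_entries A) \<in>
      frac_of (det_divisor (n - k) A) \<cdot>\<^sub>F frac_of (det_divisor k (A * B))"
    using y unfolding frac_of_det_divisor[OF A(1)]
      frac_of_det_divisor[OF B]
      frac_of_det_divisor[OF mult_carrier_mat[OF A(1) B]] by blast
qed

lemma det_divisor_top_times_left_factor:
  assumes A: "A \<in> carrier_mat n n" and B: "B \<in> carrier_mat n n" "det B \<noteq> 0" and k: "k \<le> n"
    and y: "y \<in> frac_of (det_divisor k A)" and p: "p \<in> frac_of (det_divisor n B)"
  shows "y * p \<in> frac_of (det_divisor (n - k) B) \<cdot>\<^sub>F frac_of (det_divisor k (A * B))"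
proof (rule mult_det_divisor_top[OF B(1) subspace_frac_mult _ p])
  have nz: "fdet n (fract_entries B) \<noteq> 0" using fdet_fract_entries[OF B(1)] B(2) by simp
  have "minor_module k n (fract_entries A) \<subseteq> {w. w * fdet n (fract_entries B) \<in>
      minor_module (n - k) n (fract_entries B) \<cdot>\<^sub>F minor_module k n (fract_entries (A * B))}"
    by (rule det_times_minor_left_factor[OF _ nz k]) (rule fract_entries_mult[OF A B(1)])
  then show "y * fdet n (fract_entries B) \<in>
      frac_of (det_divisor (n - k) B) \<cdot>\<^sub>F frac_of (det_divisor k (A * B))"
    using y unfolding frac_of_det_divisor[OF A]
      frac_of_det_divisor[OF B(1)]
      frac_of_det_divisor[OF mult_carrier_mat[OF A B(1)]] by blast
qed

text \<open>
  The two summands are bounded separately: the first one because \<open>B\<close> is a right factor of \<open>AB\<close>, the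
  second one because \<open>A\<close> is a left factor.
\<close>

lemma det_divisor_mult_upper_bound:
  assumes A: "A \<in> carrier_mat n n" "det A \<noteq> 0" and B: "B \<in> carrier_mat n n" "det B \<noteq> 0"
    and k: "k \<le> n"
  defines "DA \<equiv> \<lambda>k. frac_of (det_divisor k A)" and "DB \<equiv> \<lambda>k. frac_of (det_divisor k B)"
  shows "frac_of (det_divisor k (A * B)) dvd\<^sub>F
    DA k \<cdot>\<^sub>F DB k \<cdot>\<^sub>F
      (DA n \<cdot>\<^sub>F frac_inv (DA k) \<cdot>\<^sub>F frac_inv (DA (n - k))
       +\<^sub>F DB n \<cdot>\<^sub>F frac_inv (DB k) \<cdot>\<^sub>F frac_inv (DB (n - k)))"
  unfolding frac_dvd_def
proof (rule frac_mult3_leI[OF subspace_det_divisor])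
  let ?C = "frac_of (det_divisor k (A * B))"
  fix x y z assume x: "x \<in> DA k" and y: "y \<in> DB k"
    and "z \<in> DA n \<cdot>\<^sub>F frac_inv (DA k) \<cdot>\<^sub>F frac_inv (DA (n - k))
      +\<^sub>F DB n \<cdot>\<^sub>F frac_inv (DB k) \<cdot>\<^sub>F frac_inv (DB (n - k))"
  then obtain u v where z: "z = u + v"
    and u: "u \<in> DA n \<cdot>\<^sub>F frac_inv (DA k) \<cdot>\<^sub>F frac_inv (DA (n - k))"
    and v: "v \<in> DB n \<cdot>\<^sub>F frac_inv (DB k) \<cdot>\<^sub>F frac_inv (DB (n - k))"
    unfolding frac_plus_def by blast
  have "x * y * u \<in> ?C"
  proof (rule scaled_product_in_subspace[OF subspace_det_divisor _ x y u])
    show "y * p \<in> DA (n - k) \<cdot>\<^sub>F ?C" if "y \<in> DB k" "p \<in> DA n" for y p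
      using det_divisor_top_times_right_factor[OF A B(1) k] that unfolding DA_def DB_def by blast
  qed
  moreover have "y * x * v \<in> ?C"
  proof (rule scaled_product_in_subspace[OF subspace_det_divisor _ y x v])
    show "x * p \<in> DB (n - k) \<cdot>\<^sub>F ?C" if "x \<in> DA k" "p \<in> DB n" for x p
      using det_divisor_top_times_left_factor[OF A(1) B k] that unfolding DA_def DB_def by blast
  qed
  moreover have "x * y * z = x * y * u + y * x * v"
    unfolding z by (simp add: algebra_simps)
  ultimately show "x * y * z \<in> ?C"
    using fract_module.subspace_add[OF subspace_det_divisor] by metis
qed

section \<open>Necessary conditions for realisability\<close>

theorem corollary3p3:
  fixes n :: nat
    and a b c :: "nat \<Rightarrow> 'a::idom set"
  assumes "dedekind_domain TYPE('a)"
    and "n > 0"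
    and "\<And>k. k \<in> {1..n} \<Longrightarrow> ideal (a k) class_ring \<and> a k \<noteq> {0}"
    and "\<And>k. k \<in> {1..n} \<Longrightarrow> ideal (b k) class_ring \<and> b k \<noteq> {0}"
    and "\<And>k. k \<in> {1..n} \<Longrightarrow> ideal (c k) class_ring \<and> c k \<noteq> {0}"
    and "\<not> (
      (principalideal (a n) class_ring \<and> principalideal (b n) class_ring \<and>
         principalideal (c n) class_ring) \<and>
      (n \<ge> 2 \<longrightarrow>
         frac_of (a 1) \<cdot>\<^sub>F frac_of (a 1) dvd\<^sub>F frac_of (a 2) \<and>
         frac_of (b 1) \<cdot>\<^sub>F frac_of (b 1) dvd\<^sub>F frac_of (b 2) \<and>
         frac_of (c 1) \<cdot>\<^sub>F frac_of (c 1) dvd\<^sub>F frac_of (c 2)) \<and>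
      (\<forall>k \<in> {3..n}.
         frac_of (a (k - 1)) \<cdot>\<^sub>F frac_of (a (k - 1)) \<cdot>\<^sub>F frac_inv (frac_of (a (k - 2))) dvd\<^sub>F frac_of (a k) \<and>
         frac_of (b (k - 1)) \<cdot>\<^sub>F frac_of (b (k - 1)) \<cdot>\<^sub>F frac_inv (frac_of (b (k - 2))) dvd\<^sub>F frac_of (b k) \<and>
         frac_of (c (k - 1)) \<cdot>\<^sub>F frac_of (c (k - 1)) \<cdot>\<^sub>F frac_inv (frac_of (c (k - 2))) dvd\<^sub>F frac_of (c k)) \<and>
      frac_of (a n) \<cdot>\<^sub>F frac_of (b n) = frac_of (c n) \<and>
      (\<forall>k \<in> {1..<n}. frac_of (a k) \<cdot>\<^sub>F frac_of (b k) dvd\<^sub>F frac_of (c k)) \<and>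
      (\<forall>k \<in> {1..<n}.
         frac_of (c k) dvd\<^sub>F
           frac_of (a k) \<cdot>\<^sub>F frac_of (b k) \<cdot>\<^sub>F
             (frac_of (a n) \<cdot>\<^sub>F frac_inv (frac_of (a k)) \<cdot>\<^sub>F frac_inv (frac_of (a (n - k)))
              +\<^sub>F frac_of (b n) \<cdot>\<^sub>F frac_inv (frac_of (b k)) \<cdot>\<^sub>F frac_inv (frac_of (b (n - k))))))"
  shows "\<not> realisable n a b c"
proof
  note dd = assms(1)
  assume "realisable n a b c"
  then obtain A B where AB: "A \<in> nonsing_mats n" "B \<in> nonsing_mats n"
    and div: "\<forall>k \<in> {1..n}. det_divisor k A = a k \<and> det_divisor k B = b k \<and>
      det_divisor k (A * B) = c k"
    unfolding realisable_def by blast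
  from AB have A: "A \<in> carrier_mat n n" "det A \<noteq> 0" and B: "B \<in> carrier_mat n n" "det B \<noteq> 0"
    unfolding nonsing_mats_def by auto
  have C: "A * B \<in> carrier_mat n n" using A B by simp
  have a: "a k = det_divisor k A" and b: "b k = det_divisor k B" and c: "c k = det_divisor k (A * B)"
    if "k \<in> {1..n}" for k
    using div that by auto
  have nn: "n \<in> {1..n}" using assms(2) by simp
  note 1 = det_divisor_top_principal[OF A(1), folded a[OF nn]]
    det_divisor_top_principal[OF B(1), folded b[OF nn]] det_divisor_top_principal[OF C, folded c[OF nn]]
  have 2: "frac_of (a 1) \<cdot>\<^sub>F frac_of (a 1) dvd\<^sub>F frac_of (a 2) \<and>
      frac_of (b 1) \<cdot>\<^sub>F frac_of (b 1) dvd\<^sub>F frac_of (b 2) \<and>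
      frac_of (c 1) \<cdot>\<^sub>F frac_of (c 1) dvd\<^sub>F frac_of (c 2)" if n: "n \<ge> 2"
  proof -
    have k: "1 \<in> {1..n}" "2 \<in> {1..n}" using n by auto
    show ?thesis
      unfolding a[OF k(1)] a[OF k(2)] b[OF k(1)] b[OF k(2)] c[OF k(1)] c[OF k(2)]
      by (intro conjI det_divisor_1_square_dvd[OF dd _ n] A(1) B(1) C)
  qed
  have 3: "frac_of (a (k - 1)) \<cdot>\<^sub>F frac_of (a (k - 1)) \<cdot>\<^sub>F frac_inv (frac_of (a (k - 2))) dvd\<^sub>F frac_of (a k) \<and>
      frac_of (b (k - 1)) \<cdot>\<^sub>F frac_of (b (k - 1)) \<cdot>\<^sub>F frac_inv (frac_of (b (k - 2))) dvd\<^sub>F frac_of (b k) \<and>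
      frac_of (c (k - 1)) \<cdot>\<^sub>F frac_of (c (k - 1)) \<cdot>\<^sub>F frac_inv (frac_of (c (k - 2))) dvd\<^sub>F frac_of (c k)"
    if "k \<in> {3..n}" for k
  proof -
    have k: "k \<in> {1..n}" "k - 1 \<in> {1..n}" "k - 2 \<in> {1..n}" "2 \<le> k" "k \<le> n" using that by auto
    have nz: "det_divisor (k - 2) A \<noteq> {0}" "det_divisor (k - 2) B \<noteq> {0}"
        "det_divisor (k - 2) (A * B) \<noteq> {0}"
      using assms(3-5)[OF k(3)] unfolding a[OF k(3)] b[OF k(3)] c[OF k(3)] by simp_all
    show ?thesis
      unfolding a[OF k(1)] a[OF k(2)] a[OF k(3)] b[OF k(1)] b[OF k(2)] b[OF k(3)]
        c[OF k(1)] c[OF k(2)] c[OF k(3)]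
      by (intro conjI det_divisor_square_quotient_dvd[OF dd _ k(4,5)] A(1) B(1) C nz)
  qed
  have 4: "frac_of (a n) \<cdot>\<^sub>F frac_of (b n) = frac_of (c n)"
    unfolding a[OF nn] b[OF nn] c[OF nn] by (rule det_divisor_top_mult[OF A(1) B(1)])
  have 5: "frac_of (a k) \<cdot>\<^sub>F frac_of (b k) dvd\<^sub>F frac_of (c k)" if "k \<in> {1..<n}" for k
  proof -
    have k: "k \<in> {1..n}" using that by simp
    show ?thesis unfolding a[OF k] b[OF k] c[OF k] by (rule det_divisor_mult_dvd[OF A(1) B(1)])
  qed
  have 6: "frac_of (c k) dvd\<^sub>F
      frac_of (a k) \<cdot>\<^sub>F frac_of (b k) \<cdot>\<^sub>F
        (frac_of (a n) \<cdot>\<^sub>F frac_inv (frac_of (a k)) \<cdot>\<^sub>F frac_inv (frac_of (a (n - k)))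
         +\<^sub>F frac_of (b n) \<cdot>\<^sub>F frac_inv (frac_of (b k)) \<cdot>\<^sub>F frac_inv (frac_of (b (n - k))))"
    if "k \<in> {1..<n}" for k
  proof -
    have k: "k \<in> {1..n}" "n - k \<in> {1..n}" "k \<le> n" using that by auto
    show ?thesis
      unfolding a[OF nn] b[OF nn] a[OF k(1)] b[OF k(1)] c[OF k(1)] a[OF k(2)] b[OF k(2)]
      by (rule det_divisor_mult_upper_bound[OF A B k(3)])
  qed
  show False using assms(6) 1 2 3 4 5 6 by blast
qed

end
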